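(* Let $T>0$ and consider the system of ODEs $\dot y(t)=F_D(y(t))+F_A(y(t))$, $y(0)=y_0\in\mathbb{R}^d$, on the time interval $[0,T]$, where $F_D$ and $F_A$ (maps from $\mathbb{R}^d$ to $\mathbb{R}^d$) are of class $\mathcal{C}^2$ and are Lipschitz continuous. Suppose in addition that the first and second derivatives of $F_D$ and $F_A$ are bounded. Let $N\in\mathbb{N}$, $h=T/N$, and $t_n=nh$, $n=1,\dots,N$, and consider the ARKC method (defined in the context) applied to this system with step size $h$, such that the number of stages $s$ and the damping parameter $\eta$ are chosen appropriately to guarantee stability. Let $y_1,\dots,y_N$ be the resulting numerical approximations. Then, for all $n=1,\dots,N$, $$\|y(t_n)-y_n\|\le Ch^2,$$ where $C$ is independent of $h$ and $n$. In other words, the method converges with order $2$.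
   Context: $\|\cdot\|$ is a norm on $\mathbb{R}^d$ and $y(t)$ denotes the exact solution of the system. Chebyshev polynomials of the first kind: $T_0(x)=1$, $T_1(x)=x$, $T_j(x)=2xT_{j-1}(x)-T_{j-2}(x)$ for $j\ge2$. Of the second kind: $U_0(x)=1$, $U_1(x)=2x$, $U_j(x)=2xU_{j-1}(x)-U_{j-2}(x)$ for $j\ge2$. Coefficients: for an integer $s\ge2$ (number of stages) and a damping parameter $\eta\ge0$, set $$\omega_0=1+\frac{\eta}{s^2},\qquad \omega_2=\frac{T_s'(\omega_0)}{T_s''(\omega_0)},\qquad b_j=\frac{T_j''(\omega_0)}{(T_j'(\omega_0))^2}\ (2\le j\le s),\qquad b_0=b_1=b_2,$$ $$a_j=1-b_jT_j(\omega_0)\ (0\le j\le s),\qquad \alpha=\left(1-\frac{\omega_2}{2}\right)b_1s\,\omega_2,$$ and, for $j=2,\dots,s$, $$\mu_j=\frac{2b_j\omega_2}{b_{j-1}},\qquad \nu_j=\frac{2b_j\omega_0}{b_{j-1}},\qquad \kappa_j=-\frac{b_j}{b_{j-2}}.$$ ARKC method: one step $y_n\mapsto y_{n+1}$ with step size $h$ is $$G=hF_A\Big(y_n+\tfrac h2F_A\big(y_n+\tfrac{\omega_2}{2}hF_D(y_n)\big)+\tfrac h2F_D(y_n)\Big)+hF_D\Big(y_n+\tfrac{\omega_2-1}{2}hF_A(y_n)\Big)-hF_D(y_n),$$ $$K_0=y_n+\tfrac{\omega_2}{2}G,\qquad K_1=K_0+b_1\omega_2hF_D(y_n)+\alpha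 G,$$ and, for $j=2,\dots,s$, $$K_j=\mu_jh\big(F_D(K_{j-1})-F_D(K_0)+(1-a_{j-1})F_D(y_n)\big)+\nu_jK_{j-1}+\kappa_jK_{j-2}+(1-\nu_j-\kappa_j)K_0,$$ with $y_{n+1}=K_s$. Stability: the theorem asks only that $s$ and $\eta$ be chosen appropriately to guarantee stability, without giving a formal condition. As background, stability of such a method is studied on the scalar linear test problem $\dot y=\lambda y+i\mu y$ with $\lambda\le0$, $\mu\in\mathbb{R}$ ($\lambda y$ playing the role of $F_D$ and $i\mu y$ that of $F_A$). There one step reads $y_{n+1}=R_s(p,q)y_n$ with $p=h\lambda$, $q=h\mu$ and $$R_s(p,q)=a_s+b_sT_s(\omega_0+\omega_2p)+\left(\frac{\omega_2}{2}+\left(1-\frac{\omega_2}{2}\right)\frac{U_{s-1}(\omega_0+\omega_2p)}{U_{s-1}(\omega_0)}\right)\left(1+\frac{\omega_2}{2}p\right)\left(iq-\frac{q^2}{2}\right),$$ and the stability domain is $\{(p,q)\in\mathbb{R}^2:\ |R_s(p,q)|\le1\}$. This linear analysis is meant only to give insight into the stability of the method on general problems. *)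

theory Defs
  imports "HOL-Analysis.Analysis" "HOL-Computational_Algebra.Polynomial"
begin

text \<open>An arbitrary norm on a real vector space, as opposed to the type class \<open>norm\<close>, which on
  \<^typ>\<open>real ^ 'd\<close> is fixed to be the Euclidean one.\<close>

definition is_norm :: "('a::real_vector \<Rightarrow> real) \<Rightarrow> bool" where
  "is_norm nrm \<longleftrightarrow>
     (\<forall>x. 0 \<le> nrm x) \<and>
     (\<forall>x. nrm x = 0 \<longleftrightarrow> x = 0) \<and>
     (\<forall>c x. nrm (c *\<^sub>R x) = \<bar>c\<bar> * nrm x) \<and>
     (\<forall>x y. nrm (x + y) \<le> nrm x + nrm y)"

text \<open>\<open>F\<close> is of class C2 with first and second Frechet derivatives \<open>F'\<close> and \<open>F''\<close>. Continuity of
  \<open>F''\<close> is with respect to the operator norm; \<open>F\<close> and \<open>F'\<close> are continuous because they are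
  differentiable.\<close>

definition C2_with_derivs ::
  "('a::real_normed_vector \<Rightarrow> 'b::real_normed_vector) \<Rightarrow> ('a \<Rightarrow> 'a \<Rightarrow>\<^sub>L 'b) \<Rightarrow>
   ('a \<Rightarrow> 'a \<Rightarrow>\<^sub>L ('a \<Rightarrow>\<^sub>L 'b)) \<Rightarrow> bool" where
  "C2_with_derivs F F' F'' \<longleftrightarrow>
     (\<forall>x. (F has_derivative blinfun_apply (F' x)) (at x)) \<and>
     (\<forall>x. (F' has_derivative blinfun_apply (F'' x)) (at x)) \<and>
     continuous_on UNIV F''"

text \<open>Chebyshev polynomials of the first kind.\<close>

fun cheb_T :: "nat \<Rightarrow> real poly" where
  "cheb_T 0 = 1"
| "cheb_T (Suc 0) = [:0, 1:]"
| "cheb_T (Suc (Suc j)) = [:0, 2:] * cheb_T (Suc j) - cheb_T j"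

text \<open>The coefficients of the method with \<open>s\<close> stages and damping parameter \<open>\<eta>\<close>. They are meant
  for \<open>s \<ge> 2\<close> and \<open>\<eta> \<ge> 0\<close>, and \<open>arkc_\<mu>\<close>, \<open>arkc_\<nu>\<close>, \<open>arkc_\<kappa>\<close> for index at least \<open>2\<close>.\<close>

definition arkc_\<omega>0 :: "nat \<Rightarrow> real \<Rightarrow> real" where
  "arkc_\<omega>0 s \<eta> = 1 + \<eta> / (real s)\<^sup>2"

definition arkc_\<omega>2 :: "nat \<Rightarrow> real \<Rightarrow> real" where
  "arkc_\<omega>2 s \<eta> =
     poly (pderiv (cheb_T s)) (arkc_\<omega>0 s \<eta>) / poly (pderiv (pderiv (cheb_T s))) (arkc_\<omega>0 s \<eta>)"

definition arkc_b :: "nat \<Rightarrow> real \<Rightarrow> nat \<Rightarrow> real" where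
  "arkc_b s \<eta> j =
     (let i = (if j < 2 then 2 else j) in
      poly (pderiv (pderiv (cheb_T i))) (arkc_\<omega>0 s \<eta>) / (poly (pderiv (cheb_T i)) (arkc_\<omega>0 s \<eta>))\<^sup>2)"

definition arkc_a :: "nat \<Rightarrow> real \<Rightarrow> nat \<Rightarrow> real" where
  "arkc_a s \<eta> j = 1 - arkc_b s \<eta> j * poly (cheb_T j) (arkc_\<omega>0 s \<eta>)"

definition arkc_\<alpha> :: "nat \<Rightarrow> real \<Rightarrow> real" where
  "arkc_\<alpha> s \<eta> = (1 - arkc_\<omega>2 s \<eta> / 2) * arkc_b s \<eta> 1 * real s * arkc_\<omega>2 s \<eta>"

definition arkc_\<mu> :: "nat \<Rightarrow> real \<Rightarrow> nat \<Rightarrow> real" where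
  "arkc_\<mu> s \<eta> j = 2 * arkc_b s \<eta> j * arkc_\<omega>2 s \<eta> / arkc_b s \<eta> (j - 1)"

definition arkc_\<nu> :: "nat \<Rightarrow> real \<Rightarrow> nat \<Rightarrow> real" where
  "arkc_\<nu> s \<eta> j = 2 * arkc_b s \<eta> j * arkc_\<omega>0 s \<eta> / arkc_b s \<eta> (j - 1)"

definition arkc_\<kappa> :: "nat \<Rightarrow> real \<Rightarrow> nat \<Rightarrow> real" where
  "arkc_\<kappa> s \<eta> j = - arkc_b s \<eta> j / arkc_b s \<eta> (j - 2)"

definition arkc_G ::
  "('a::real_vector \<Rightarrow> 'a) \<Rightarrow> ('a \<Rightarrow> 'a) \<Rightarrow> nat \<Rightarrow> real \<Rightarrow> real \<Rightarrow> 'a \<Rightarrow> 'a" where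
  "arkc_G F_D F_A s \<eta> h y =
     (let \<omega>2 = arkc_\<omega>2 s \<eta> in
      h *\<^sub>R F_A (y + (h / 2) *\<^sub>R F_A (y + (\<omega>2 / 2 * h) *\<^sub>R F_D y) + (h / 2) *\<^sub>R F_D y)
      + h *\<^sub>R F_D (y + ((\<omega>2 - 1) / 2 * h) *\<^sub>R F_A y)
      - h *\<^sub>R F_D y)"

text \<open>The internal stages of one step of size \<open>h\<close> starting from \<open>y\<close>. The coefficients depend on the
  total number of stages \<open>s\<close>; the last argument is the stage index.\<close>

fun arkc_K ::
  "('a::real_vector \<Rightarrow> 'a) \<Rightarrow> ('a \<Rightarrow> 'a) \<Rightarrow> nat \<Rightarrow> real \<Rightarrow> real \<Rightarrow> 'a \<Rightarrow> nat \<Rightarrow> 'a" where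
  "arkc_K F_D F_A s \<eta> h y 0 = y + (arkc_\<omega>2 s \<eta> / 2) *\<^sub>R arkc_G F_D F_A s \<eta> h y"
| "arkc_K F_D F_A s \<eta> h y (Suc 0) =
     arkc_K F_D F_A s \<eta> h y 0
     + (arkc_b s \<eta> 1 * arkc_\<omega>2 s \<eta> * h) *\<^sub>R F_D y
     + arkc_\<alpha> s \<eta> *\<^sub>R arkc_G F_D F_A s \<eta> h y"
| "arkc_K F_D F_A s \<eta> h y (Suc (Suc i)) =
     (let j = Suc (Suc i) in
      (arkc_\<mu> s \<eta> j * h) *\<^sub>R
        (F_D (arkc_K F_D F_A s \<eta> h y (Suc i)) - F_D (arkc_K F_D F_A s \<eta> h y 0)
         + (1 - arkc_a s \<eta> (j - 1)) *\<^sub>R F_D y)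
      + arkc_\<nu> s \<eta> j *\<^sub>R arkc_K F_D F_A s \<eta> h y (Suc i)
      + arkc_\<kappa> s \<eta> j *\<^sub>R arkc_K F_D F_A s \<eta> h y i
      + (1 - arkc_\<nu> s \<eta> j - arkc_\<kappa> s \<eta> j) *\<^sub>R arkc_K F_D F_A s \<eta> h y 0)"

definition arkc_step ::
  "('a::real_vector \<Rightarrow> 'a) \<Rightarrow> ('a \<Rightarrow> 'a) \<Rightarrow> nat \<Rightarrow> real \<Rightarrow> real \<Rightarrow> 'a \<Rightarrow> 'a" where
  "arkc_step F_D F_A s \<eta> h y = arkc_K F_D F_A s \<eta> h y s"

text \<open>The approximation after \<open>n\<close> steps of size \<open>h\<close> from the initial value \<open>y0\<close>.\<close>

definition arkc ::
  "('a::real_vector \<Rightarrow> 'a) \<Rightarrow> ('a \<Rightarrow> 'a) \<Rightarrow> nat \<Rightarrow> real \<Rightarrow> real \<Rightarrow> 'a \<Rightarrow> nat \<Rightarrow> 'a" where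
  "arkc F_D F_A s \<eta> h y0 n = (arkc_step F_D F_A s \<eta> h ^^ n) y0"

text \<open>Parameter choice. In the convergence theorem \<open>s N\<close> and \<open>\<eta> N\<close> are the number of stages and the
  damping used with \<open>N\<close> steps. They may depend on the step size, as in practice, where the number of
  stages is adapted to the step size to keep the method stable. Any \<open>s N \<ge> 2\<close>, however large, and
  any \<open>\<eta> N\<close> in a bounded range are allowed (a fixed \<open>\<eta>\<close> is a special case), so every
  stability-motivated selection within this range is covered and no separate stability
  hypothesis is imposed. Some bound on the damping is needed: for \<open>s = 2\<close> one has
  \<open>\<omega>2 = \<omega>0 = 1 + \<eta> / 4\<close>, so a rapidly growing \<open>\<eta> N\<close> spoils the consistency error.\<close>

end

theory Submission
  imports Defs
begin

text \<open>A one-step method of consistency order 2 whose step map is Lipschitz with constant \<open>1 + C h\<close>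
converges with order 2: a local error \<open>O(h\<^sup>3)\<close> is committed \<open>N = T / h\<close> times and amplified by at most
\<open>(1 + C h) ^ N \<le> exp (C T)\<close>. The substance is that both constants can be chosen independently of
the number of stages and of the damping in its bounded range, both of which may vary with the step
size.

Everything about the stages follows from one representation (\<open>scaled_increment_representation\<close>).
Writing \<open>K\<^sub>j = K\<^sub>0 + b\<^sub>j E\<^sub>j\<close> turns the three-term recursion of the stages into the Chebyshev recursion
with a source term, so that \<open>E\<^sub>j\<close> is the sum of \<open>\<omega>\<^sub>2 T\<^sub>j' h F_D(y)\<close>, a multiple \<open>\<beta> U\<^sub>j\<^sub>-\<^sub>1\<close> of
\<open>G\<close>, and a discrete convolution of \<open>2 \<omega>\<^sub>2 h U\<^sub>j\<^sub>-\<^sub>1\<^sub>-\<^sub>k\<close> with \<open>(F_D(K\<^sub>k) - F_D(K\<^sub>0)) / b\<^sub>k\<close>, all polynomials being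
evaluated at \<open>\<omega>\<^sub>0\<close>.

Uniformity in \<open>s\<close>. Since \<open>\<omega>\<^sub>0 - 1 = \<eta> / s\<^sup>2\<close>, the values \<open>U\<^sub>k\<^sub>-\<^sub>1(\<omega>\<^sub>0)\<close> for \<open>k \<le> s\<close> lie between \<open>k\<close> and
\<open>exp(2 \<eta>) k\<close>. Hence \<open>b\<^sub>j\<close> and \<open>1 / b\<^sub>j\<close> are bounded, \<open>\<omega>\<^sub>2\<close> is \<open>O(1 / s\<^sup>2)\<close> and \<open>\<beta>\<close> is \<open>O(1 / s)\<close>; the
convolution kernel is \<open>O(h (j - k) / s\<^sup>2)\<close>, and its sum over all stages is \<open>O(h)\<close>. A discrete
Gronwall argument for this kernel (\<open>volterra_gronwall\<close>, \<open>stage_gronwall\<close>) bounds \<open>E\<^sub>j\<close> by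
\<open>O(h) j / s\<close> and, applied to the difference of two runs, gives the Lipschitz constant of the step
(\<open>arkc_step_lipschitz\<close>).

Order 2. Iterating the representation once, the coefficients of the elementary differentials are
convolutions of Chebyshev values that evaluate to \<open>T\<^sub>s''\<close>: \<open>\<Sum> U\<^sub>s\<^sub>-\<^sub>1\<^sub>-\<^sub>k T\<^sub>k' = T\<^sub>s'' / 4\<close> and
\<open>\<Sum> U\<^sub>s\<^sub>-\<^sub>1\<^sub>-\<^sub>k U\<^sub>k\<^sub>-\<^sub>1 = T\<^sub>s'' / (2 s)\<close>. With \<open>b\<^sub>s = T\<^sub>s'' / T\<^sub>s'\<^sup>2\<close> and \<open>\<omega>\<^sub>2 = T\<^sub>s' / T\<^sub>s''\<close> the step becomes
\<open>y + h F_D + G + h\<^sup>2/2 F_D' F_D + (1 - \<omega>\<^sub>2/2) h F_D' G + O(h\<^sup>3)\<close>, and \<open>G\<close> contains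
\<open>h\<^sup>2 (\<omega>\<^sub>2 - 1)/2 F_D' F_A\<close>, which completes the coefficient of \<open>F_D' F_A\<close> to \<open>1/2\<close>
(\<open>arkc_step_expansion\<close>). The result is the Taylor step of the exact solution
(\<open>solution_expansion\<close>).\<close>

section \<open>Chebyshev values and convolutions\<close>

text \<open>The value \<open>U\<^sub>n\<^sub>-\<^sub>1(x)\<close> of the Chebyshev polynomial of the second kind. The index is shifted so that the
sequence starts at \<open>0\<close>: it is the fundamental solution of the Chebyshev recursion, and
convolutions with it need no boundary terms.\<close>

fun chebS :: "real \<Rightarrow> nat \<Rightarrow> real" where
  "chebS x 0 = 0"
| "chebS x (Suc 0) = 1"
| "chebS x (Suc (Suc n)) = 2 * x * chebS x (Suc n) - chebS x n"

text \<open>Variation of constants for the Chebyshev recursion: by linearity each source term \<open>g k\<close> spreads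
like a fundamental solution started at \<open>k\<close>. It is applied to the derivatives of \<open>T\<^sub>n\<close> and, with
vector values, to the stages of the method.\<close>

lemma cheb_recurrence_solution:
  fixes a g :: "nat \<Rightarrow> 'a::real_vector"
  assumes a0: "a 0 = 0"
    and rec: "\<And>k. a (Suc (Suc k)) = (2 * x) *\<^sub>R a (Suc k) - a k + g (Suc k)"
  shows "a n = chebS x n *\<^sub>R a 1 + (\<Sum>k\<in>{1..<n}. chebS x (n - k) *\<^sub>R g k)"
proof (induction n rule: induct_nat_012)
  case (ge2 n)
  let ?\<Sigma> = "\<lambda>m. \<Sum>k\<in>{1..<Suc n}. chebS x (m - k) *\<^sub>R g k"
  have split: "chebS x (Suc (Suc n) - k) = 2 * x * chebS x (Suc n - k) - chebS x (n - k)"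
    if "k \<in> {1..<Suc n}" for k
  proof -
    have "Suc (Suc n) - k = Suc (Suc (n - k))" "Suc n - k = Suc (n - k)" using that by auto
    then show ?thesis by simp
  qed
  have low: "?\<Sigma> n = (\<Sum>k\<in>{1..<n}. chebS x (n - k) *\<^sub>R g k)"
    by (cases n) (simp_all)
  have "?\<Sigma> (Suc (Suc n)) = (\<Sum>k\<in>{1..<Suc n}. (2 * x) *\<^sub>R (chebS x (Suc n - k) *\<^sub>R g k) - chebS x (n - k) *\<^sub>R g k)"
    by (rule sum.cong) (simp_all only: split scaleR_left_diff_distrib scaleR_scaleR)
  also have "\<dots> = (2 * x) *\<^sub>R ?\<Sigma> (Suc n) - ?\<Sigma> n"
    by (simp add: sum_subtractf scaleR_sum_right del: sum.op_ivl_Suc)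
  finally have *: "?\<Sigma> (Suc (Suc n)) = (2 * x) *\<^sub>R ?\<Sigma> (Suc n) - ?\<Sigma> n" .
  have "(\<Sum>k\<in>{1..<Suc (Suc n)}. chebS x (Suc (Suc n) - k) *\<^sub>R g k) = ?\<Sigma> (Suc (Suc n)) + g (Suc n)"
    by (subst sum.atLeastLessThan_Suc) auto
  then show ?case
    unfolding rec[of n] ge2 * low by (simp add: algebra_simps)
qed (simp_all add: a0)

lemma cheb_T_eq_chebS: "poly (cheb_T n) x = chebS x (Suc n) - x * chebS x n"
proof (induction n rule: cheb_T.induct)
  case (3 n)
  have "poly (cheb_T (Suc (Suc n))) x = 2 * x * poly (cheb_T (Suc n)) x - poly (cheb_T n) x"
    by simp
  then show ?case unfolding 3 by (simp add: algebra_simps)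
qed simp_all

lemma pderiv_cheb_T_eq_chebS: "poly (pderiv (cheb_T n)) x = real n * chebS x n"
proof (induction n rule: cheb_T.induct)
  case (3 n)
  then show ?case
    by (simp add: pderiv_mult pderiv_diff pderiv_pCons pderiv_smult cheb_T_eq_chebS algebra_simps)
qed (simp_all add: pderiv_pCons pderiv_smult)

lemma pderiv_cheb_T_eq_sum:
  "poly (pderiv (cheb_T n)) x = chebS x n + 2 * (\<Sum>k\<in>{1..<n}. chebS x (n - k) * poly (cheb_T k) x)"
proof -
  have "poly (pderiv (cheb_T n)) x = chebS x n *\<^sub>R poly (pderiv (cheb_T 1)) x
      + (\<Sum>k\<in>{1..<n}. chebS x (n - k) *\<^sub>R (2 * poly (cheb_T k) x))"
    by (rule cheb_recurrence_solution) (simp_all add: pderiv_mult pderiv_diff pderiv_pCons pderiv_smult algebra_simps)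
  then show ?thesis by (simp add: pderiv_pCons pderiv_smult sum_distrib_left mult_ac)
qed

lemma pderiv2_cheb_T_eq_sum:
  "poly (pderiv (pderiv (cheb_T n))) x
     = 4 * (\<Sum>k\<in>{1..<n}. chebS x (n - k) * poly (pderiv (cheb_T k)) x)"
proof -
  have "poly (pderiv (pderiv (cheb_T n))) x = chebS x n *\<^sub>R poly (pderiv (pderiv (cheb_T 1))) x
      + (\<Sum>k\<in>{1..<n}. chebS x (n - k) *\<^sub>R (4 * poly (pderiv (cheb_T k)) x))"
    by (rule cheb_recurrence_solution)
      (simp_all add: pderiv_mult pderiv_diff pderiv_pCons pderiv_smult pderiv_add algebra_simps)
  then show ?thesis by (simp add: pderiv_pCons pderiv_smult sum_distrib_left mult_ac)
qed

text \<open>In the preceding convolution \<open>T\<^sub>k' = k U\<^sub>k\<^sub>-\<^sub>1\<close>, and reflecting \<open>k\<close> to \<open>n - k\<close> shows that the weight \<open>k\<close> may be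
replaced by its mean \<open>n / 2\<close>.\<close>

lemma pderiv2_cheb_T_eq_convolution:
  "poly (pderiv (pderiv (cheb_T n))) x = 2 * real n * (\<Sum>k\<in>{1..<n}. chebS x (n - k) * chebS x k)"
proof -
  let ?c = "\<lambda>k. chebS x (n - k) * chebS x k"
  have "(\<Sum>k\<in>{1..<n}. real k * ?c k) = (\<Sum>k\<in>{1..<n}. real (n - k) * ?c k)"
    by (rule sum.reindex_bij_witness[of _ "\<lambda>k. n - k" "\<lambda>k. n - k"]) auto
  then have "2 * (\<Sum>k\<in>{1..<n}. real k * ?c k)
      = (\<Sum>k\<in>{1..<n}. real k * ?c k + real (n - k) * ?c k)"
    by (simp add: sum.distrib)
  also have "\<dots> = real n * (\<Sum>k\<in>{1..<n}. ?c k)"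
    unfolding sum_distrib_left by (rule sum.cong) (auto simp: of_nat_diff algebra_simps)
  finally have "2 * (\<Sum>k\<in>{1..<n}. real k * ?c k) = real n * (\<Sum>k\<in>{1..<n}. ?c k)" .
  moreover have "poly (pderiv (pderiv (cheb_T n))) x = 4 * (\<Sum>k\<in>{1..<n}. real k * ?c k)"
    by (simp add: pderiv2_cheb_T_eq_sum pderiv_cheb_T_eq_chebS mult_ac)
  ultimately show ?thesis by simp
qed

lemma chebS_lower:
  assumes "1 \<le> x"
  shows "real n \<le> chebS x n" and chebS_step: "1 \<le> chebS x (Suc n) - chebS x n"
proof -
  have "real n \<le> chebS x n \<and> 1 \<le> chebS x (Suc n) - chebS x n"
  proof (induction n)
    case (Suc n)
    have "0 \<le> (x - 1) * chebS x (Suc n)" using assms Suc by (intro mult_nonneg_nonneg) auto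
    moreover have "chebS x (Suc (Suc n)) - chebS x (Suc n)
        = chebS x (Suc n) - chebS x n + 2 * ((x - 1) * chebS x (Suc n))"
      by (simp add: algebra_simps)
    ultimately show ?case using Suc by simp
  qed simp
  then show "real n \<le> chebS x n" "1 \<le> chebS x (Suc n) - chebS x n" by auto
qed

text \<open>The increments of the sequence are themselves increasing, so the value at \<open>n + 1\<close> is at most \<open>n + 1\<close>
times the last increment; the recursion then lets the increments grow by a factor of at most
\<open>1 + 2 \<epsilon> m\<close> per step. For \<open>\<epsilon> = \<eta> / m\<^sup>2\<close> this is linear growth up to the factor \<open>exp (2 \<eta>)\<close>.\<close>

lemma chebS_upper:
  assumes "0 \<le> \<epsilon>" "n < m"
  shows "chebS (1 + \<epsilon>) (Suc n) \<le> real (Suc n) * (1 + 2 * \<epsilon> * real m) ^ n"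
proof -
  let ?S = "chebS (1 + \<epsilon>)"
  let ?\<Delta> = "\<lambda>k. ?S (Suc k) - ?S k"
  have pos: "0 \<le> ?S k" for k using chebS_lower(1)[of "1 + \<epsilon>" k] assms by (simp add: order_trans[of 0 "real k"])
  have main: "?S (Suc n) \<le> real (Suc n) * ?\<Delta> n \<and> ?\<Delta> n \<le> (1 + 2 * \<epsilon> * real m) ^ n" if "n < m" for n
    using that
  proof (induction n)
    case (Suc n)
    then have IH: "?S (Suc n) \<le> real (Suc n) * ?\<Delta> n" "?\<Delta> n \<le> (1 + 2 * \<epsilon> * real m) ^ n" by auto
    have rec: "?\<Delta> (Suc n) = ?\<Delta> n + 2 * \<epsilon> * ?S (Suc n)" by (simp add: algebra_simps)
    have \<Delta>0: "0 \<le> ?\<Delta> n" using chebS_step[of "1 + \<epsilon>" n] assms by simp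
    have "0 \<le> \<epsilon> * ?S (Suc n)" using pos assms by (intro mult_nonneg_nonneg) 
    then have "real (Suc n) * ?\<Delta> n \<le> real (Suc n) * ?\<Delta> (Suc n)" unfolding rec
      by (intro mult_left_mono) auto
    then have 1: "?S (Suc (Suc n)) \<le> real (Suc (Suc n)) * ?\<Delta> (Suc n)"
      using IH(1) by (simp add: algebra_simps)
    have "?S (Suc n) \<le> real m * ?\<Delta> n"
      using IH(1) mult_right_mono[OF _ \<Delta>0, of "real (Suc n)" "real m"] Suc.prems by simp
    then have "2 * \<epsilon> * ?S (Suc n) \<le> 2 * \<epsilon> * (real m * ?\<Delta> n)" using assms by (intro mult_left_mono) auto
    then have "?\<Delta> (Suc n) \<le> (1 + 2 * \<epsilon> * real m) * ?\<Delta> n" unfolding rec by (simp add: algebra_simps)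
    also have "\<dots> \<le> (1 + 2 * \<epsilon> * real m) * (1 + 2 * \<epsilon> * real m) ^ n"
      using IH(2) assms by (intro mult_left_mono) auto
    finally show ?case using 1 by simp
  qed simp
  from main[OF assms(2)] have "?S (Suc n) \<le> real (Suc n) * ?\<Delta> n" "?\<Delta> n \<le> (1 + 2 * \<epsilon> * real m) ^ n"
    by auto
  then show ?thesis by (meson mult_left_mono of_nat_0_le_iff order_trans)
qed

text \<open>The value of \<open>T\<^sub>n''(1) / 4\<close>, which bounds \<open>T\<^sub>n'' / 4\<close> from below at every point to the right of \<open>1\<close>.\<close>

lemma sum_weighted_squares:
  "(\<Sum>k\<in>{1..<n}. real (n - k) * (real k)\<^sup>2) = (real n)\<^sup>2 * ((real n)\<^sup>2 - 1) / 12"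
proof (induction n)
  case (Suc n)
  have sq: "(\<Sum>k\<in>{1..<Suc n}. (real k)\<^sup>2) = real n * (real n + 1) * (2 * real n + 1) / 6"
    by (induction n) (auto simp: field_simps power2_eq_square)
  have "(\<Sum>k\<in>{1..<Suc n}. real (Suc n - k) * (real k)\<^sup>2)
      = (\<Sum>k\<in>{1..<Suc n}. real (n - k) * (real k)\<^sup>2 + (real k)\<^sup>2)"
    by (rule sum.cong) (auto simp: of_nat_diff algebra_simps)
  also have "\<dots> = (\<Sum>k\<in>{1..<n}. real (n - k) * (real k)\<^sup>2) + (\<Sum>k\<in>{1..<Suc n}. (real k)\<^sup>2)"
    unfolding sum.distrib by (cases n) auto
  finally show ?case unfolding Suc.IH sq by (simp add: field_simps power2_eq_square)
qed simp

section \<open>A discrete Gronwall inequality for the stages\<close>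

text \<open>The kernel \<open>c (j - k) / s\<^sup>2\<close> is at most \<open>(c / s) (j / s)\<close>, so its action on a geometric sequence
\<open>(1 + c / s) ^ k\<close> is a telescoping sum and reproduces the bound exactly with no smallness
condition on \<open>c\<close>.\<close>

lemma volterra_gronwall:
  fixes e :: "nat \<Rightarrow> real"
  assumes B: "0 \<le> B" and c: "0 \<le> c" and s: "0 < s" and "j \<le> s"
    and step: "\<And>j. j \<le> s \<Longrightarrow>
      e j \<le> B * (real j / real s) + c / (real s)\<^sup>2 * (\<Sum>k\<in>{1..<j}. real (j - k) * e k)"
  shows "e j \<le> B * (real j / real s) * (1 + c / real s) ^ j"
  using \<open>j \<le> s\<close>
proof (induction j rule: less_induct)
  case (less j)
  let ?q = "1 + c / real s"
  have "c / (real s)\<^sup>2 * (real (j - k) * e k) \<le> B * (real j / real s) * (c / real s * ?q ^ k)"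
    if k: "k \<in> {1..<j}" for k
  proof -
    have "e k \<le> B * (real k / real s) * ?q ^ k" using less k by auto
    also have "\<dots> \<le> B * 1 * ?q ^ k"
      using k less.prems B c s by (intro mult_right_mono mult_left_mono) auto
    finally have "real (j - k) * e k \<le> real (j - k) * (B * ?q ^ k)" by (intro mult_left_mono) auto
    also have "\<dots> \<le> real j * (B * ?q ^ k)" using B c s by (intro mult_right_mono) auto
    finally have "c / (real s)\<^sup>2 * (real (j - k) * e k) \<le> c / (real s)\<^sup>2 * (real j * (B * ?q ^ k))"
      using c by (intro mult_left_mono) auto
    then show ?thesis by (simp add: power2_eq_square mult_ac)
  qed
  then have "c / (real s)\<^sup>2 * (\<Sum>k\<in>{1..<j}. real (j - k) * e k)
      \<le> (\<Sum>k\<in>{1..<j}. B * (real j / real s) * (c / real s * ?q ^ k))"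
    unfolding sum_distrib_left by (rule sum_mono)
  also have "\<dots> = B * (real j / real s) * (\<Sum>k\<in>{1..<j}. c / real s * ?q ^ k)"
    by (simp add: sum_distrib_left)
  also have "\<dots> \<le> B * (real j / real s) * (\<Sum>k<j. c / real s * ?q ^ k)"
    using B c s by (intro mult_left_mono sum_mono2) auto
  also have "(\<Sum>k<j. c / real s * ?q ^ k) = ?q ^ j - 1"
    by (induction j) (auto simp: algebra_simps)
  finally show ?case using step[OF less.prems] by (simp add: algebra_simps)
qed

lemma one_plus_over_power_le_exp:
  assumes "0 \<le> c" "0 < s" "j \<le> s"
  shows "(1 + c / real s) ^ j \<le> exp c"
proof -
  have "(1 + c / real s) ^ j \<le> (1 + c / real s) ^ s"
    using assms by (intro power_increasing) auto
  also have "\<dots> \<le> exp (c / real s) ^ s"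
    using assms by (intro power_mono) auto
  also have "\<dots> = exp c"
    using assms by (simp flip: exp_of_nat_mult)
  finally show ?thesis .
qed

section \<open>The coefficients of the method, uniformly in the number of stages\<close>

text \<open>The constant \<open>\<Lambda>\<close> stands for the effect of the damping: every bound below depends on \<open>\<Lambda>\<close> alone and
thus holds for all numbers of stages and all dampings in a bounded range at once.\<close>

locale arkc_params =
  fixes s :: nat and \<eta> \<Lambda> :: real
  assumes two_le_s: "2 \<le> s" and damping_nonneg: "0 \<le> \<eta>" and exp_damping: "exp (2 * \<eta>) \<le> \<Lambda>"
begin

abbreviation "\<omega>0 \<equiv> arkc_\<omega>0 s \<eta>"
abbreviation "S \<equiv> chebS \<omega>0"
abbreviation "dT \<equiv> \<lambda>k. poly (pderiv (cheb_T k)) \<omega>0"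
abbreviation "ddT \<equiv> \<lambda>k. poly (pderiv (pderiv (cheb_T k))) \<omega>0"
abbreviation "b \<equiv> arkc_b s \<eta>"
abbreviation "\<omega>2 \<equiv> arkc_\<omega>2 s \<eta>"

text \<open>The coefficient \<open>\<alpha> / b\<^sub>1\<close>, that is, the effect of \<open>G\<close> on the first stage in the scaling in which the
stages satisfy the Chebyshev recursion.\<close>

definition "\<beta> = (1 - \<omega>2 / 2) * real s * \<omega>2"

lemma \<Lambda>_ge_1: "1 \<le> \<Lambda>"
  using exp_damping damping_nonneg one_le_exp_iff[of "2 * \<eta>"] by linarith

lemma \<omega>0_ge_1: "1 \<le> \<omega>0"
  using damping_nonneg by (simp add: arkc_\<omega>0_def)

lemma S_ge: "real k \<le> S k"
  by (rule chebS_lower[OF \<omega>0_ge_1])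

lemma S_nonneg: "0 \<le> S k"
  using S_ge[of k] by linarith

lemma S_le:
  assumes "k \<le> s"
  shows "S k \<le> \<Lambda> * real k"
proof (cases k)
  case (Suc n)
  then have n: "n < s" using assms by simp
  have eq: "2 * (\<eta> / (real s)\<^sup>2) * real s = 2 * \<eta> / real s"
    using two_le_s by (simp add: power2_eq_square)
  have "S k \<le> real k * (1 + 2 * \<eta> / real s) ^ n"
    using chebS_upper[of "\<eta> / (real s)\<^sup>2" n s] damping_nonneg n Suc unfolding arkc_\<omega>0_def eq by simp
  also have "\<dots> \<le> real k * \<Lambda>"
    using one_plus_over_power_le_exp[of "2 * \<eta>" s n] damping_nonneg n exp_damping
    by (intro mult_left_mono) auto
  finally show ?thesis by (simp add: mult.commute)
qed simp

lemma dT_eq: "dT k = real k * S k"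
  by (rule pderiv_cheb_T_eq_chebS)

lemma dT_ge: "(real k)\<^sup>2 \<le> dT k"
  unfolding dT_eq power2_eq_square by (intro mult_left_mono S_ge) auto

lemma dT_le: "k \<le> s \<Longrightarrow> dT k \<le> \<Lambda> * (real k)\<^sup>2"
  using mult_left_mono[OF S_le, of k "real k"] by (simp add: dT_eq power2_eq_square mult_ac)

lemma dT_nonneg: "0 \<le> dT k"
  using dT_ge[of k] by (meson order_trans zero_le_power2)

lemma dT_pos: "0 < k \<Longrightarrow> 0 < dT k"
  using dT_ge[of k] by (smt (verit) of_nat_0_less_iff zero_less_power)

lemma ddT_ge:
  assumes "2 \<le> k"
  shows "(real k) ^ 4 / 4 \<le> ddT k"
proof -
  have k2: "4 \<le> (real k)\<^sup>2"
    using power_mono[of 2 "real k" 2] assms by simp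
  have "(real k) ^ 4 / 4 \<le> 4 * ((real k)\<^sup>2 * ((real k)\<^sup>2 - 1) / 12)"
  proof -
    have "v * v / 4 \<le> 4 * (v * (v - 1) / 12)" if "4 \<le> v" for v :: real
      using mult_left_mono[OF that, of v] that by (simp add: right_diff_distrib)
    from this[OF k2] show ?thesis by (simp flip: power_add)
  qed
  also have "\<dots> = 4 * (\<Sum>i\<in>{1..<k}. real (k - i) * (real i)\<^sup>2)"
    by (simp only: sum_weighted_squares)
  also have "\<dots> \<le> ddT k"
    unfolding pderiv2_cheb_T_eq_sum
    by (intro mult_left_mono sum_mono mult_mono S_ge dT_ge S_nonneg) auto
  finally show ?thesis .
qed

lemma ddT_le:
  assumes "k \<le> s"
  shows "ddT k \<le> 4 * \<Lambda>\<^sup>2 * (real k) ^ 4"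
proof -
  have "S (k - i) * dT i \<le> \<Lambda>\<^sup>2 * (real k) ^ 3" if "i \<in> {1..<k}" for i
  proof -
    have "S (k - i) \<le> \<Lambda> * real (k - i)" using assms by (intro S_le) auto
    also have "\<dots> \<le> \<Lambda> * real k" using \<Lambda>_ge_1 by (intro mult_left_mono) auto
    finally have 1: "S (k - i) \<le> \<Lambda> * real k" .
    have "dT i \<le> \<Lambda> * (real i)\<^sup>2" using assms that by (intro dT_le) auto
    also have "\<dots> \<le> \<Lambda> * (real k)\<^sup>2" using \<Lambda>_ge_1 that by (intro mult_left_mono power_mono) auto
    finally have "S (k - i) * dT i \<le> (\<Lambda> * real k) * (\<Lambda> * (real k)\<^sup>2)"
      using 1 \<Lambda>_ge_1 by (intro mult_mono dT_nonneg) auto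
    then show ?thesis by (simp add: power2_eq_square power3_eq_cube mult_ac)
  qed
  then have "(\<Sum>i\<in>{1..<k}. S (k - i) * dT i) \<le> real (card {1..<k}) * (\<Lambda>\<^sup>2 * (real k) ^ 3)"
    by (rule sum_bounded_above)
  also have "\<dots> \<le> real k * (\<Lambda>\<^sup>2 * (real k) ^ 3)" by (intro mult_right_mono) auto
  also have "\<dots> = \<Lambda>\<^sup>2 * (real k) ^ 4" by (simp add: power_numeral_reduce)
  finally show ?thesis unfolding pderiv2_cheb_T_eq_sum by linarith
qed

lemma b_eq: "\<exists>i. 2 \<le> i \<and> (j \<le> s \<longrightarrow> i \<le> s) \<and> b j = ddT i / (dT i)\<^sup>2"
  using two_le_s by (intro exI[of _ "if j < 2 then 2 else j"]) (auto simp: arkc_b_def Let_def)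

lemma b_pos: "0 < b j"
proof -
  obtain i where i: "2 \<le> i" "b j = ddT i / (dT i)\<^sup>2"
    using b_eq[of j] by (elim exE conjE) (rule that)
  have "0 < ddT i" using i(1) by (intro order_less_le_trans[OF _ ddT_ge[OF i(1)]]) simp
  then show ?thesis using dT_pos[of i] i by simp
qed

lemma b_le:
  assumes "j \<le> s"
  shows "b j \<le> 4 * \<Lambda>\<^sup>2"
proof -
  obtain i where i: "2 \<le> i" "i \<le> s" "b j = ddT i / (dT i)\<^sup>2" using b_eq[of j] assms by auto
  have "((real i)\<^sup>2)\<^sup>2 \<le> (dT i)\<^sup>2" using dT_ge by (intro power_mono) auto
  then have "(real i) ^ 4 \<le> (dT i)\<^sup>2" by simp
  then have "4 * \<Lambda>\<^sup>2 * (real i) ^ 4 \<le> 4 * \<Lambda>\<^sup>2 * (dT i)\<^sup>2" by (intro mult_left_mono) auto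
  then have "ddT i \<le> 4 * \<Lambda>\<^sup>2 * (dT i)\<^sup>2" using ddT_le[OF i(2)] by linarith
  moreover have "0 < (dT i)\<^sup>2" using dT_pos[of i] i(1) by simp
  ultimately show ?thesis unfolding i(3) by (simp only: pos_divide_le_eq)
qed

lemma inverse_b_le:
  assumes "j \<le> s"
  shows "1 / b j \<le> 4 * \<Lambda>\<^sup>2"
proof -
  obtain i where i: "2 \<le> i" "i \<le> s" "b j = ddT i / (dT i)\<^sup>2" using b_eq[of j] assms by auto
  have dd: "0 < ddT i" using b_pos[of j] i dT_pos[of i] by (simp add: zero_less_divide_iff)
  have "(dT i)\<^sup>2 \<le> (\<Lambda> * (real i)\<^sup>2)\<^sup>2" using dT_le[OF i(2)] by (intro power_mono dT_nonneg) auto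
  also have "\<dots> = 4 * \<Lambda>\<^sup>2 * ((real i) ^ 4 / 4)" by (simp add: power_mult_distrib)
  also have "\<dots> \<le> 4 * \<Lambda>\<^sup>2 * ddT i" using ddT_ge[OF i(1)] by (intro mult_left_mono) auto
  finally have "(dT i)\<^sup>2 / ddT i \<le> 4 * \<Lambda>\<^sup>2" using dd by (simp only: pos_divide_le_eq)
  then show ?thesis unfolding i(3) by simp
qed

lemma ddT_s_pos: "0 < ddT s"
  using two_le_s by (intro order_less_le_trans[OF _ ddT_ge[OF two_le_s]]) simp

lemma \<omega>2_pos: "0 < \<omega>2"
  using ddT_s_pos dT_pos[of s] two_le_s by (simp add: arkc_\<omega>2_def)

lemma \<omega>2_le: "\<omega>2 \<le> 4 * \<Lambda> / (real s)\<^sup>2"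
proof -
  have "dT s * (real s)\<^sup>2 \<le> \<Lambda> * (real s)\<^sup>2 * (real s)\<^sup>2" using dT_le[of s] by (intro mult_right_mono) auto
  also have "\<dots> = 4 * \<Lambda> * ((real s) ^ 4 / 4)" by (simp add: mult.assoc flip: power_add)
  also have "\<dots> \<le> 4 * \<Lambda> * ddT s" using ddT_ge[OF two_le_s] \<Lambda>_ge_1 by (intro mult_left_mono) auto
  finally have "dT s \<le> 4 * \<Lambda> * ddT s / (real s)\<^sup>2" using two_le_s by (simp add: pos_le_divide_eq)
  then show ?thesis unfolding arkc_\<omega>2_def using ddT_s_pos by (simp add: pos_divide_le_eq)
qed

lemma \<omega>2_le_\<Lambda>: "\<omega>2 \<le> \<Lambda>"
proof -
  have "4 \<le> (real s)\<^sup>2" using power_mono[of 2 "real s" 2] two_le_s by simp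
  then have "4 * \<Lambda> / (real s)\<^sup>2 \<le> 4 * \<Lambda> / 4" using \<Lambda>_ge_1 two_le_s by (intro divide_left_mono) auto
  then show ?thesis using \<omega>2_le by simp
qed

lemma \<omega>2_half_bounds:
  "\<bar>\<omega>2 / 2\<bar> \<le> \<Lambda>" "\<bar>(\<omega>2 - 1) / 2\<bar> \<le> \<Lambda>" "\<bar>1 - \<omega>2 / 2\<bar> \<le> 1 + \<Lambda>"
  using \<omega>2_pos \<omega>2_le_\<Lambda> \<Lambda>_ge_1 by (simp_all add: abs_le_iff field_simps)

lemma \<beta>_le: "\<bar>\<beta>\<bar> \<le> 6 * \<Lambda>\<^sup>2 / real s"
proof -
  have "\<bar>\<beta>\<bar> = \<bar>1 - \<omega>2 / 2\<bar> * (real s * \<omega>2)" using \<omega>2_pos by (simp add: \<beta>_def abs_mult)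
  also have "\<dots> \<le> (3 / 2 * \<Lambda>) * (4 * \<Lambda> / real s)"
  proof (rule mult_mono)
    show "\<bar>1 - \<omega>2 / 2\<bar> \<le> 3 / 2 * \<Lambda>" using \<omega>2_pos \<omega>2_le_\<Lambda> \<Lambda>_ge_1 by linarith
    have "real s * \<omega>2 \<le> real s * (4 * \<Lambda> / (real s)\<^sup>2)" using \<omega>2_le by (intro mult_left_mono) auto
    then show "real s * \<omega>2 \<le> 4 * \<Lambda> / real s" using two_le_s by (simp add: power2_eq_square)
  qed (use \<omega>2_pos \<Lambda>_ge_1 in auto)
  finally show ?thesis by (simp add: power2_eq_square)
qed

lemma \<alpha>_eq: "arkc_\<alpha> s \<eta> = b 1 * \<beta>"
  by (simp add: arkc_\<alpha>_def \<beta>_def)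

lemma b_s_eq: "b s = ddT s / (dT s)\<^sup>2"
  using two_le_s by (simp add: arkc_b_def)

lemma dT_s_nonzero: "dT s \<noteq> 0" and ddT_s_nonzero: "ddT s \<noteq> 0"
  using ddT_s_pos dT_pos[of s] two_le_s by linarith+

text \<open>The order conditions. The names tell which order and which of the two contributions, that of
\<open>F_D(y)\<close> or that of \<open>G\<close>, they concern. Those of second order need the convolution formulas for
\<open>T\<^sub>s''\<close>.\<close>

lemma order1_D: "b s * (\<omega>2 * dT s) = 1"
proof -
  have "B / A\<^sup>2 * (A / B * A) = 1" if "A \<noteq> 0" "B \<noteq> 0" for A B :: real
    using that by (simp add: power2_eq_square)
  from this[OF dT_s_nonzero ddT_s_nonzero] show ?thesis by (simp only: b_s_eq arkc_\<omega>2_def)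
qed

lemma b_\<omega>2_sq: "b s * \<omega>2\<^sup>2 * ddT s = 1"
proof -
  have "B / A\<^sup>2 * (A / B)\<^sup>2 * B = 1" if "A \<noteq> 0" "B \<noteq> 0" for A B :: real
    using that by (simp add: power2_eq_square)
  from this[OF dT_s_nonzero ddT_s_nonzero] show ?thesis by (simp only: b_s_eq arkc_\<omega>2_def)
qed

lemma order1_G: "b s * (S s * \<beta>) = 1 - \<omega>2 / 2"
proof -
  have "b s * (S s * \<beta>) = (1 - \<omega>2 / 2) * (b s * (\<omega>2 * dT s))"
    unfolding \<beta>_def dT_eq by (simp only: mult_ac)
  then show ?thesis by (simp only: order1_D mult_1_right)
qed

lemma order2_D: "b s * (\<Sum>k\<in>{1..<s}. 2 * \<omega>2 * S (s - k) * (\<omega>2 * dT k)) = 1 / 2"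
proof -
  have "(\<Sum>k\<in>{1..<s}. 2 * \<omega>2 * S (s - k) * (\<omega>2 * dT k))
      = 2 * \<omega>2\<^sup>2 * (\<Sum>k\<in>{1..<s}. S (s - k) * dT k)"
    unfolding sum_distrib_left power2_eq_square by (simp only: mult_ac)
  also have "\<dots> = \<omega>2\<^sup>2 * ddT s / 2"
    unfolding pderiv2_cheb_T_eq_sum[of s] by simp
  finally have "b s * (\<Sum>k\<in>{1..<s}. 2 * \<omega>2 * S (s - k) * (\<omega>2 * dT k)) = (b s * \<omega>2\<^sup>2 * ddT s) / 2"
    by (simp only: mult.assoc times_divide_eq_right)
  then show ?thesis unfolding b_\<omega>2_sq .
qed

lemma order2_G: "b s * (\<Sum>k\<in>{1..<s}. 2 * \<omega>2 * S (s - k) * (S k * \<beta>)) = 1 - \<omega>2 / 2"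
proof -
  have "(\<Sum>k\<in>{1..<s}. 2 * \<omega>2 * S (s - k) * (S k * \<beta>))
      = 2 * \<omega>2 * \<beta> * (\<Sum>k\<in>{1..<s}. S (s - k) * S k)"
    unfolding sum_distrib_left by (simp only: mult_ac)
  also have "\<dots> = (1 - \<omega>2 / 2) * (\<omega>2\<^sup>2 * ddT s)"
    unfolding pderiv2_cheb_T_eq_convolution[of s] \<beta>_def power2_eq_square by (simp only: mult_ac)
  finally have "b s * (\<Sum>k\<in>{1..<s}. 2 * \<omega>2 * S (s - k) * (S k * \<beta>))
      = (1 - \<omega>2 / 2) * (b s * \<omega>2\<^sup>2 * ddT s)"
    by (simp only: mult_ac)
  then show ?thesis unfolding b_\<omega>2_sq by simp
qed

section \<open>The internal stages\<close>

text \<open>Dividing by \<open>b\<^sub>j\<close> removes the stage-dependent factors from \<open>\<nu>\<^sub>j\<close> and \<open>\<kappa>\<^sub>j\<close> and leaves the constant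
coefficients \<open>2 \<omega>\<^sub>0\<close> and \<open>-1\<close> of the Chebyshev recursion.\<close>

definition scaled_increment ::
  "('a::real_vector \<Rightarrow> 'a) \<Rightarrow> ('a \<Rightarrow> 'a) \<Rightarrow> real \<Rightarrow> 'a \<Rightarrow> nat \<Rightarrow> 'a" where
  "scaled_increment F_D F_A h y j =
     (1 / b j) *\<^sub>R (arkc_K F_D F_A s \<eta> h y j - arkc_K F_D F_A s \<eta> h y 0)"

lemma stage_eq:
  "arkc_K F_D F_A s \<eta> h y j = arkc_K F_D F_A s \<eta> h y 0 + b j *\<^sub>R scaled_increment F_D F_A h y j"
  using b_pos[of j] by (simp add: scaled_increment_def)

text \<open>Variation of constants for the stages. The source term also contains \<open>2 \<omega>\<^sub>2 h T\<^sub>k F_D(y)\<close>, because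
\<open>1 - a\<^sub>k = b\<^sub>k T\<^sub>k\<close>; summed against the fundamental solution it combines with the initial value into
\<open>\<omega>\<^sub>2 T\<^sub>j' h F_D(y)\<close>.\<close>

lemma scaled_increment_representation:
  fixes F_D F_A :: "'a::real_vector \<Rightarrow> 'a"
  shows "scaled_increment F_D F_A h y j =
     (\<omega>2 * dT j * h) *\<^sub>R F_D y + (S j * \<beta>) *\<^sub>R arkc_G F_D F_A s \<eta> h y
     + (\<Sum>k\<in>{1..<j}. (2 * \<omega>2 * h * S (j - k)) *\<^sub>R ((1 / b k) *\<^sub>R
         (F_D (arkc_K F_D F_A s \<eta> h y k) - F_D (arkc_K F_D F_A s \<eta> h y 0))))"
proof -
  let ?K = "arkc_K F_D F_A s \<eta> h y" and ?E = "scaled_increment F_D F_A h y"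
  let ?G = "arkc_G F_D F_A s \<eta> h y"
  let ?v = "\<lambda>k. (1 / b k) *\<^sub>R (F_D (?K k) - F_D (?K 0))"
  define g where "g k = (2 * \<omega>2 * h) *\<^sub>R (?v k + poly (cheb_T k) \<omega>0 *\<^sub>R F_D y)" for k
  have b0: "b k \<noteq> 0" for k using b_pos[of k] by simp
  have rec: "?E (Suc (Suc k)) = (2 * \<omega>0) *\<^sub>R ?E (Suc k) - ?E k + g (Suc k)" for k
  proof -
    let ?b1 = "b (Suc k)" and ?b2 = "b (Suc (Suc k))" and ?b = "b k"
    have K: "?K (Suc (Suc k)) - ?K 0 = (2 * ?b2 * \<omega>2 / ?b1 * h) *\<^sub>R
          (F_D (?K (Suc k)) - F_D (?K 0) + (?b1 * poly (cheb_T (Suc k)) \<omega>0) *\<^sub>R F_D y)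
        + (2 * ?b2 * \<omega>0 / ?b1) *\<^sub>R (?K (Suc k) - ?K 0) - (?b2 / ?b) *\<^sub>R (?K k - ?K 0)"
      by (simp add: Let_def arkc_\<mu>_def arkc_\<nu>_def arkc_\<kappa>_def arkc_a_def algebra_simps)
    have c: "1 / ?b2 * (2 * ?b2 * \<omega>2 / ?b1 * h) = 2 * \<omega>2 * h * (1 / ?b1)"
      "1 / ?b2 * (2 * ?b2 * \<omega>0 / ?b1) = 2 * \<omega>0 * (1 / ?b1)" "1 / ?b2 * (?b2 / ?b) = 1 / ?b"
      using b0 by auto
    let ?V = "F_D (?K (Suc k)) - F_D (?K 0) + (?b1 * poly (cheb_T (Suc k)) \<omega>0) *\<^sub>R F_D y"
    have "?E (Suc (Suc k)) = (1 / ?b2 * (2 * ?b2 * \<omega>2 / ?b1 * h)) *\<^sub>R ?V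
        + (1 / ?b2 * (2 * ?b2 * \<omega>0 / ?b1)) *\<^sub>R (?K (Suc k) - ?K 0) - (1 / ?b2 * (?b2 / ?b)) *\<^sub>R (?K k - ?K 0)"
      unfolding scaled_increment_def K
      by (simp only: scaleR_right_distrib scaleR_right_diff_distrib scaleR_scaleR mult.assoc)
    also have "\<dots> = (2 * \<omega>2 * h * (1 / ?b1)) *\<^sub>R ?V
        + (2 * \<omega>0 * (1 / ?b1)) *\<^sub>R (?K (Suc k) - ?K 0) - (1 / ?b) *\<^sub>R (?K k - ?K 0)"
      unfolding c ..
    finally have "?E (Suc (Suc k)) = (2 * \<omega>2 * h * (1 / ?b1)) *\<^sub>R ?V
        + (2 * \<omega>0 * (1 / ?b1)) *\<^sub>R (?K (Suc k) - ?K 0) - (1 / ?b) *\<^sub>R (?K k - ?K 0)" .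
    then show ?thesis
      using b0 by (simp add: scaled_increment_def g_def scaleR_right_distrib del: arkc_K.simps)
  qed
  have E1: "?E 1 = (\<omega>2 * h) *\<^sub>R F_D y + \<beta> *\<^sub>R ?G"
    using b0[of 1] by (simp add: scaled_increment_def \<alpha>_eq scaleR_right_distrib)
  have "?E j = S j *\<^sub>R ?E 1 + (\<Sum>k\<in>{1..<j}. S (j - k) *\<^sub>R g k)"
    by (rule cheb_recurrence_solution[of ?E]) (use rec in \<open>simp_all add: scaled_increment_def\<close>)
  also have "(\<Sum>k\<in>{1..<j}. S (j - k) *\<^sub>R g k)
      = (\<Sum>k\<in>{1..<j}. (2 * \<omega>2 * h * S (j - k)) *\<^sub>R ?v k
          + (\<omega>2 * h * (2 * (S (j - k) * poly (cheb_T k) \<omega>0))) *\<^sub>R F_D y)"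
    by (rule sum.cong) (simp_all add: g_def scaleR_right_distrib mult_ac)
  also have "\<dots> = (\<Sum>k\<in>{1..<j}. (2 * \<omega>2 * h * S (j - k)) *\<^sub>R ?v k)
      + (\<omega>2 * h * (2 * (\<Sum>k\<in>{1..<j}. S (j - k) * poly (cheb_T k) \<omega>0))) *\<^sub>R F_D y"
    unfolding sum.distrib scaleR_sum_left[symmetric] sum_distrib_left ..
  finally show ?thesis
    unfolding E1 pderiv_cheb_T_eq_sum by (simp add: algebra_simps)
qed

text \<open>The kernel is \<open>O(h / s)\<close> and there are at most \<open>s\<close> stages; perturbations of the stage derivatives
therefore enter the final stage with weight \<open>O(h)\<close>, however many stages there are.\<close>

lemma kernel_sum_le:
  assumes "0 \<le> h" "j \<le> s"
  shows "(\<Sum>k\<in>{1..<j}. 2 * \<omega>2 * h * S (j - k)) \<le> 8 * \<Lambda>\<^sup>2 * h"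
proof -
  have "2 * \<omega>2 * h * S (j - k) \<le> 8 * \<Lambda>\<^sup>2 * h / real s" if k: "k \<in> {1..<j}" for k
  proof -
    have "S (j - k) \<le> \<Lambda> * real (j - k)" using assms by (intro S_le) auto
    also have "\<dots> \<le> \<Lambda> * real s" using assms \<Lambda>_ge_1 by (intro mult_left_mono) auto
    finally have "2 * \<omega>2 * h * S (j - k) \<le> 2 * (4 * \<Lambda> / (real s)\<^sup>2) * h * (\<Lambda> * real s)"
      using assms \<Lambda>_ge_1 \<omega>2_pos by (intro mult_mono S_nonneg \<omega>2_le) auto
    then show ?thesis using two_le_s by (simp add: power2_eq_square mult_ac)
  qed
  then have "(\<Sum>k\<in>{1..<j}. 2 * \<omega>2 * h * S (j - k)) \<le> real (card {1..<j}) * (8 * \<Lambda>\<^sup>2 * h / real s)"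
    by (rule sum_bounded_above)
  also have "\<dots> \<le> real s * (8 * \<Lambda>\<^sup>2 * h / real s)"
    using assms by (intro mult_right_mono) auto
  finally show ?thesis using two_le_s by simp
qed

text \<open>The bound for any quantity that satisfies the inequality suggested by the representation of the
stages: \<open>p\<close> and \<open>q\<close> stand for the sizes of \<open>h F_D(y)\<close> and \<open>G\<close>, \<open>L\<close> for a Lipschitz constant of \<open>F_D\<close>
and \<open>m\<close> for a perturbation common to all stages. It serves both for the stages of one run and for
the difference of two runs.\<close>

lemma stage_gronwall:
  fixes e w :: "nat \<Rightarrow> real"
  assumes h: "0 \<le> h" "h \<le> H" and nonneg: "0 \<le> p" "0 \<le> q" "0 \<le> m" "0 \<le> L" "\<And>k. 0 \<le> e k"
    and e: "\<And>j. j \<le> s \<Longrightarrow> e j \<le> \<omega>2 * dT j * p + S j * \<bar>\<beta>\<bar> * q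
              + (\<Sum>k\<in>{1..<j}. 2 * \<omega>2 * h * S (j - k) * w k)"
    and w: "\<And>k. k \<le> s \<Longrightarrow> w k \<le> L * e k + m"
    and j: "j \<le> s"
  shows "e j \<le> 8 * \<Lambda> ^ 3 * exp (8 * \<Lambda>\<^sup>2 * H * L) * (p + q + h * m) * (real j / real s)"
proof -
  note s = two_le_s and L1 = \<Lambda>_ge_1
  define B where "B = 4 * \<Lambda>\<^sup>2 * p + 6 * \<Lambda> ^ 3 * q + 8 * \<Lambda>\<^sup>2 * h * m"
  define c where "c = 8 * \<Lambda>\<^sup>2 * h * L"
  have B0: "0 \<le> B" and c0: "0 \<le> c" using h nonneg L1 by (auto simp: B_def c_def)
  have step: "e j \<le> B * (real j / real s) + c / (real s)\<^sup>2 * (\<Sum>k\<in>{1..<j}. real (j - k) * e k)"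
    if j: "j \<le> s" for j
  proof -
    have js: "real j / real s \<le> 1" using j s by simp
    have jj: "(real j)\<^sup>2 / (real s)\<^sup>2 \<le> real j / real s"
      using mult_left_mono[OF js, of "real j / real s"] by (simp add: power2_eq_square)
    have "\<omega>2 * dT j \<le> (4 * \<Lambda> / (real s)\<^sup>2) * (\<Lambda> * (real j)\<^sup>2)"
      using L1 by (intro mult_mono \<omega>2_le dT_le j dT_nonneg) auto
    also have "\<dots> = 4 * \<Lambda>\<^sup>2 * ((real j)\<^sup>2 / (real s)\<^sup>2)" by (simp add: power2_eq_square)
    also have "\<dots> \<le> 4 * \<Lambda>\<^sup>2 * (real j / real s)" using jj by (intro mult_left_mono) auto
    finally have t1: "\<omega>2 * dT j * p \<le> 4 * \<Lambda>\<^sup>2 * (real j / real s) * p"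
      using nonneg by (intro mult_right_mono)
    have "S j * \<bar>\<beta>\<bar> \<le> (\<Lambda> * real j) * (6 * \<Lambda>\<^sup>2 / real s)"
      using L1 by (intro mult_mono S_le j \<beta>_le) auto
    then have t2: "S j * \<bar>\<beta>\<bar> * q \<le> 6 * \<Lambda> ^ 3 * (real j / real s) * q"
      using nonneg by (intro mult_right_mono) (auto simp: power2_eq_square power3_eq_cube mult_ac)
    have "2 * \<omega>2 * h * S (j - k) * w k
        \<le> c / (real s)\<^sup>2 * (real (j - k) * e k) + 8 * \<Lambda>\<^sup>2 * h * m * (real j / (real s)\<^sup>2)"
      if k: "k \<in> {1..<j}" for k
    proof -
      have "2 * \<omega>2 * h * S (j - k) * w k \<le> 2 * \<omega>2 * h * S (j - k) * (L * e k + m)"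
        using \<omega>2_pos h k j by (intro mult_left_mono w mult_nonneg_nonneg S_nonneg) auto
      also have "\<dots> \<le> 2 * (4 * \<Lambda> / (real s)\<^sup>2) * h * (\<Lambda> * real (j - k)) * (L * e k + m)"
        using h L1 j nonneg \<omega>2_pos by (intro mult_right_mono mult_mono S_le S_nonneg \<omega>2_le) auto
      also have "\<dots> = c / (real s)\<^sup>2 * (real (j - k) * e k)
          + 8 * \<Lambda>\<^sup>2 * h * m * (real (j - k) / (real s)\<^sup>2)"
        by (simp add: c_def power2_eq_square algebra_simps add_divide_distrib)
      also have "\<dots> \<le> c / (real s)\<^sup>2 * (real (j - k) * e k) + 8 * \<Lambda>\<^sup>2 * h * m * (real j / (real s)\<^sup>2)"
        using h nonneg by (intro add_left_mono mult_left_mono divide_right_mono) auto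
      finally show ?thesis .
    qed
    then have "(\<Sum>k\<in>{1..<j}. 2 * \<omega>2 * h * S (j - k) * w k)
        \<le> (\<Sum>k\<in>{1..<j}. c / (real s)\<^sup>2 * (real (j - k) * e k) + 8 * \<Lambda>\<^sup>2 * h * m * (real j / (real s)\<^sup>2))"
      by (rule sum_mono)
    also have "\<dots> = c / (real s)\<^sup>2 * (\<Sum>k\<in>{1..<j}. real (j - k) * e k)
        + real (card {1..<j}) * (8 * \<Lambda>\<^sup>2 * h * m * (real j / (real s)\<^sup>2))"
      by (simp add: sum.distrib sum_distrib_left)
    also have "real (card {1..<j}) * (8 * \<Lambda>\<^sup>2 * h * m * (real j / (real s)\<^sup>2))
        \<le> real s * (8 * \<Lambda>\<^sup>2 * h * m * (real j / (real s)\<^sup>2))"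
      using h nonneg j by (intro mult_right_mono) auto
    also have "real s * (8 * \<Lambda>\<^sup>2 * h * m * (real j / (real s)\<^sup>2)) = 8 * \<Lambda>\<^sup>2 * h * m * (real j / real s)"
      using s by (simp add: power2_eq_square)
    finally have t3: "(\<Sum>k\<in>{1..<j}. 2 * \<omega>2 * h * S (j - k) * w k)
       \<le> c / (real s)\<^sup>2 * (\<Sum>k\<in>{1..<j}. real (j - k) * e k) + 8 * \<Lambda>\<^sup>2 * h * m * (real j / real s)"
      by simp
    have "B * (real j / real s) = 4 * \<Lambda>\<^sup>2 * (real j / real s) * p + 6 * \<Lambda> ^ 3 * (real j / real s) * q
        + 8 * \<Lambda>\<^sup>2 * h * m * (real j / real s)"
      by (simp add: B_def algebra_simps add_divide_distrib)
    then show ?thesis using e[OF j] t1 t2 t3 by linarith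
  qed
  have p23: "\<Lambda>\<^sup>2 \<le> \<Lambda> ^ 3" using L1 by (intro power_increasing) auto
  have L3: "0 \<le> \<Lambda> ^ 3" using L1 by simp
  have "B \<le> 8 * \<Lambda> ^ 3 * (p + q + h * m)"
  proof -
    have "4 * \<Lambda>\<^sup>2 \<le> 8 * \<Lambda> ^ 3" using p23 L3 by linarith
    then have "4 * \<Lambda>\<^sup>2 * p \<le> 8 * \<Lambda> ^ 3 * p" using nonneg by (intro mult_right_mono) auto
    moreover have "6 * \<Lambda> ^ 3 * q \<le> 8 * \<Lambda> ^ 3 * q" using L3 nonneg by (intro mult_right_mono) auto
    moreover have "8 * \<Lambda>\<^sup>2 * (h * m) \<le> 8 * \<Lambda> ^ 3 * (h * m)" using p23 h nonneg by (intro mult_right_mono) auto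
    ultimately show ?thesis by (simp add: B_def algebra_simps)
  qed
  moreover have "(1 + c / real s) ^ j \<le> exp (8 * \<Lambda>\<^sup>2 * H * L)"
  proof -
    have "(1 + c / real s) ^ j \<le> exp c"
      using one_plus_over_power_le_exp[OF c0, of s j] s j by simp
    also have "c \<le> 8 * \<Lambda>\<^sup>2 * H * L"
      unfolding c_def using h nonneg by (intro mult_right_mono mult_left_mono) auto
    finally show ?thesis by simp
  qed
  ultimately have "B * (real j / real s) * (1 + c / real s) ^ j
      \<le> 8 * \<Lambda> ^ 3 * (p + q + h * m) * (real j / real s) * exp (8 * \<Lambda>\<^sup>2 * H * L)"
    using B0 c0 h nonneg L3 by (intro mult_mono) auto
  moreover have "e j \<le> B * (real j / real s) * (1 + c / real s) ^ j"
    by (rule volterra_gronwall[OF B0 c0 _ j step]) (use s in auto)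
  ultimately show ?thesis by (simp add: mult_ac)
qed

end

section \<open>Stability: the step map is Lipschitz\<close>

lemma norm_add3_le:
  fixes u v w :: "'a::real_normed_vector"
  assumes "norm u \<le> p" "norm v \<le> q" "norm w \<le> r"
  shows "norm (u + v + w) \<le> p + q + r"
  using assms norm_triangle_ineq[of "u + v" w] norm_triangle_ineq[of u v] by linarith

lemma norm_scaleR_le:
  fixes v :: "'a::real_normed_vector"
  assumes "\<bar>c\<bar> \<le> r" "norm v \<le> q"
  shows "norm (c *\<^sub>R v) \<le> r * q"
  unfolding norm_scaleR using assms by (intro mult_mono) auto

lemma norm_diff_add_scaled:
  fixes u v w z :: "'a::real_normed_vector"
  assumes "norm (u - v) \<le> p" "norm (w - z) \<le> q" "\<bar>c\<bar> \<le> r"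
  shows "norm ((u + c *\<^sub>R w) - (v + c *\<^sub>R z)) \<le> p + r * q"
proof -
  have "(u + c *\<^sub>R w) - (v + c *\<^sub>R z) = (u - v) + c *\<^sub>R (w - z)"
    by (simp add: algebra_simps)
  then have "norm ((u + c *\<^sub>R w) - (v + c *\<^sub>R z)) \<le> norm (u - v) + \<bar>c\<bar> * norm (w - z)"
    using norm_triangle_ineq[of "u - v" "c *\<^sub>R (w - z)"] by (simp only: norm_scaleR)
  also have "\<dots> \<le> p + r * q"
    using assms by (intro add_mono mult_mono) auto
  finally show ?thesis .
qed

text \<open>The constant is of the form \<open>1 + C h\<close> because two runs differ by \<open>u - v\<close> in \<open>K\<^sub>0\<close> up to \<open>O(h)\<close>, while the
difference of the scaled increments is \<open>O(h)\<close> by \<open>stage_gronwall\<close>. The shift of \<open>K\<^sub>0\<close> itself enters the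
stages as the perturbation \<open>m\<close>; this is where boundedness of \<open>1 / b\<^sub>k\<close> is used.\<close>

lemma arkc_step_lipschitz:
  fixes F_D F_A :: "'a::real_normed_vector \<Rightarrow> 'a"
  assumes lipD: "\<And>u v. norm (F_D u - F_D v) \<le> L * norm (u - v)"
    and lipA: "\<And>u v. norm (F_A u - F_A v) \<le> L * norm (u - v)"
    and L: "0 \<le> L" and H: "0 \<le> H" and \<Lambda>: "1 \<le> \<Lambda>"
  shows "\<exists>C\<ge>0. \<forall>s \<eta> h u v. arkc_params s \<eta> \<Lambda> \<longrightarrow> 0 \<le> h \<longrightarrow> h \<le> H \<longrightarrow>
     norm (arkc_step F_D F_A s \<eta> h u - arkc_step F_D F_A s \<eta> h v) \<le> (1 + C * h) * norm (u - v)"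
proof -
  define c1 where "c1 = 1 + \<Lambda> * H * L"
  define c2 where "c2 = 1 + H * L * c1"
  define g where "g = L * (c1 + c2 + 1)"
  define m where "m = 8 * \<Lambda>\<^sup>2 * L * (1 + \<Lambda> * H * g)"
  define \<Gamma> where "\<Gamma> = 8 * \<Lambda> ^ 3 * exp (8 * \<Lambda>\<^sup>2 * H * L)"
  define C where "C = \<Lambda> * g + 4 * \<Lambda>\<^sup>2 * (\<Gamma> * (L + g + m))"
  have nonneg: "1 \<le> c1" "1 \<le> c2" "0 \<le> g" "0 \<le> m" "0 \<le> \<Gamma>" "0 \<le> C"
    using L H \<Lambda> by (auto simp: c1_def c2_def g_def m_def \<Gamma>_def C_def)
  have "norm (arkc_step F_D F_A s \<eta> h u - arkc_step F_D F_A s \<eta> h v) \<le> (1 + C * h) * norm (u - v)"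
    if "arkc_params s \<eta> \<Lambda>" and h: "0 \<le> h" "h \<le> H" for s \<eta> h u v
  proof -
    interpret arkc_params s \<eta> \<Lambda> by fact
    define d where "d = norm (u - v)"
    have d_nonneg: "0 \<le> d" by (simp add: d_def)
    let ?G = "arkc_G F_D F_A s \<eta> h" and ?K = "arkc_K F_D F_A s \<eta> h" and ?E = "scaled_increment F_D F_A h"
    note w = \<omega>2_pos \<omega>2_le_\<Lambda>
    have FD: "norm (F_D u - F_D v) \<le> L * d" and FA: "norm (F_A u - F_A v) \<le> L * d"
      using lipD lipA by (auto simp: d_def)
    have uv: "norm (u - v) \<le> d" by (simp add: d_def)
    have G: "norm (?G u - ?G v) \<le> h * (g * d)"
    proof -
      have c: "\<bar>\<omega>2 / 2 * h\<bar> \<le> \<Lambda> * H" "\<bar>h / 2\<bar> \<le> H / 2" "\<bar>(\<omega>2 - 1) / 2 * h\<bar> \<le> \<Lambda> * H"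
      proof -
        have prod: "\<bar>r * h\<bar> \<le> \<Lambda> * H" if "\<bar>r\<bar> \<le> \<Lambda>" for r
          unfolding abs_mult using that h \<Lambda> by (intro mult_mono) auto
        show "\<bar>\<omega>2 / 2 * h\<bar> \<le> \<Lambda> * H"
          by (rule prod) (rule \<omega>2_half_bounds)
        show "\<bar>(\<omega>2 - 1) / 2 * h\<bar> \<le> \<Lambda> * H"
          by (rule prod) (rule \<omega>2_half_bounds)
      qed (use h in auto)
      define a where "a y = F_A (y + (\<omega>2 / 2 * h) *\<^sub>R F_D y)" for y
      define a' where "a' y = F_A (y + (h / 2) *\<^sub>R a y + (h / 2) *\<^sub>R F_D y)" for y
      define a'' where "a'' y = F_D (y + ((\<omega>2 - 1) / 2 * h) *\<^sub>R F_A y)" for y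
      have scaled: "d + \<Lambda> * H * (L * d) = c1 * d" by (simp add: c1_def algebra_simps)
      have a: "norm (a u - a v) \<le> L * (c1 * d)"
        unfolding a_def using norm_diff_add_scaled[OF uv FD c(1)] unfolding scaled
        by (intro order_trans[OF lipA] mult_left_mono L)
      have a'': "norm (a'' u - a'' v) \<le> L * (c1 * d)"
        unfolding a''_def using norm_diff_add_scaled[OF uv FA c(3)] unfolding scaled
        by (intro order_trans[OF lipD] mult_left_mono L)
      have "norm ((u + (h / 2) *\<^sub>R a u + (h / 2) *\<^sub>R F_D u) - (v + (h / 2) *\<^sub>R a v + (h / 2) *\<^sub>R F_D v))
          \<le> d + H / 2 * (L * (c1 * d)) + H / 2 * (L * d)"
        by (rule norm_diff_add_scaled[OF norm_diff_add_scaled[OF uv a c(2)] FD c(2)])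
      also have "\<dots> \<le> d + H / 2 * (L * (c1 * d)) + H / 2 * (L * (c1 * d))"
        using L H d_nonneg nonneg mult_right_mono[of 1 c1 d] by (intro add_left_mono mult_left_mono) auto
      also have "\<dots> = c2 * d" by (simp add: c2_def algebra_simps)
      finally have a': "norm (a' u - a' v) \<le> L * (c2 * d)"
        unfolding a'_def by (intro order_trans[OF lipA] mult_left_mono L)
      have Geq: "?G y = h *\<^sub>R (a' y + a'' y - F_D y)" for y
        by (simp add: arkc_G_def Let_def a_def a'_def a''_def algebra_simps)
      have "?G u - ?G v = h *\<^sub>R ((a' u - a' v) + (a'' u - a'' v) - (F_D u - F_D v))"
        by (simp add: Geq algebra_simps)
      then have "norm (?G u - ?G v) = h * norm ((a' u - a' v) + (a'' u - a'' v) - (F_D u - F_D v))"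
        using h by simp
      also have "\<dots> \<le> h * (L * (c2 * d) + L * (c1 * d) + L * d)"
        using h a' a'' FD norm_triangle_ineq[of "a' u - a' v" "a'' u - a'' v"]
          norm_triangle_ineq4[of "(a' u - a' v) + (a'' u - a'' v)" "F_D u - F_D v"]
        by (intro mult_left_mono) linarith+
      also have "\<dots> = h * (g * d)" by (simp add: g_def algebra_simps)
      finally show ?thesis .
    qed
    define d0 where "d0 = norm (?K u 0 - ?K v 0)"
    have "d0 \<le> d + \<Lambda> * (h * (g * d))"
      unfolding d0_def arkc_K.simps using w G by (intro norm_diff_add_scaled uv) auto
    then have K0: "d0 \<le> d + \<Lambda> * g * h * d" by (simp add: mult_ac)
    also have "\<dots> \<le> d + \<Lambda> * g * H * d"
      using h \<Lambda> nonneg d_nonneg by (intro add_left_mono mult_right_mono mult_left_mono) auto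
    finally have K0': "d0 \<le> (1 + \<Lambda> * H * g) * d" by (simp add: algebra_simps)
    define e where "e k = norm (?E u k - ?E v k)" for k
    define \<phi> where "\<phi> y k = (1 / b k) *\<^sub>R (F_D (?K y k) - F_D (?K y 0))" for y k
    have e_le: "e j \<le> \<omega>2 * dT j * (h * (L * d)) + S j * \<bar>\<beta>\<bar> * (h * (g * d))
        + (\<Sum>k\<in>{1..<j}. 2 * \<omega>2 * h * S (j - k) * norm (\<phi> u k - \<phi> v k))" for j
    proof -
      have rep: "?E y j = (\<omega>2 * dT j * h) *\<^sub>R F_D y + (S j * \<beta>) *\<^sub>R ?G y
          + (\<Sum>k\<in>{1..<j}. (2 * \<omega>2 * h * S (j - k)) *\<^sub>R \<phi> y k)" for y
        unfolding \<phi>_def by (rule scaled_increment_representation)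
      have "?E u j - ?E v j = (\<omega>2 * dT j * h) *\<^sub>R (F_D u - F_D v) + (S j * \<beta>) *\<^sub>R (?G u - ?G v)
          + (\<Sum>k\<in>{1..<j}. (2 * \<omega>2 * h * S (j - k)) *\<^sub>R (\<phi> u k - \<phi> v k))"
        unfolding rep by (simp only: scaleR_right_diff_distrib sum_subtractf add_diff_add)
      also have "norm \<dots> \<le> (\<omega>2 * dT j * h) * (L * d) + S j * \<bar>\<beta>\<bar> * (h * (g * d))
          + (\<Sum>k\<in>{1..<j}. 2 * \<omega>2 * h * S (j - k) * norm (\<phi> u k - \<phi> v k))"
      proof (intro norm_add3_le norm_scaleR_le FD G)
        show "norm (\<Sum>k\<in>{1..<j}. (2 * \<omega>2 * h * S (j - k)) *\<^sub>R (\<phi> u k - \<phi> v k))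
            \<le> (\<Sum>k\<in>{1..<j}. 2 * \<omega>2 * h * S (j - k) * norm (\<phi> u k - \<phi> v k))"
          using w h S_nonneg by (intro order_trans[OF norm_sum] sum_mono norm_scaleR_le) auto
      qed (use w h dT_nonneg[of j] S_nonneg[of j] in \<open>auto simp: abs_mult\<close>)
      finally show ?thesis by (simp only: e_def mult.assoc)
    qed
    have \<phi>_le: "norm (\<phi> u k - \<phi> v k) \<le> L * e k + m * d" if k: "k \<le> s" for k
    proof -
      have bk: "0 < b k" by (rule b_pos)
      have "?K u k - ?K v k = (?K u 0 - ?K v 0) + b k *\<^sub>R (?E u k - ?E v k)"
        unfolding stage_eq[of F_D F_A h _ k] by (simp add: algebra_simps)
      then have "norm (?K u k - ?K v k) \<le> d0 + b k * e k"
        unfolding d0_def e_def using bk by (metis norm_triangle_ineq norm_scaleR abs_of_pos)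
      then have Kk: "norm (F_D (?K u k) - F_D (?K v k)) \<le> L * (d0 + b k * e k)"
        by (intro order_trans[OF lipD] mult_left_mono L)
      have K0k: "norm (F_D (?K u 0) - F_D (?K v 0)) \<le> L * d0"
        unfolding d0_def by (rule lipD)
      have "\<phi> u k - \<phi> v k = (1 / b k) *\<^sub>R ((F_D (?K u k) - F_D (?K v k)) - (F_D (?K u 0) - F_D (?K v 0)))"
        unfolding \<phi>_def by (simp add: algebra_simps)
      then have "norm (\<phi> u k - \<phi> v k)
          = 1 / b k * norm ((F_D (?K u k) - F_D (?K v k)) - (F_D (?K u 0) - F_D (?K v 0)))"
        using bk by simp
      also have "\<dots> \<le> 1 / b k * (L * (d0 + b k * e k) + L * d0)"
        using bk Kk K0k norm_triangle_ineq4[of "F_D (?K u k) - F_D (?K v k)" "F_D (?K u 0) - F_D (?K v 0)"]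
        by (intro mult_left_mono) (linarith, simp)
      also have "\<dots> = L * e k + 1 / b k * (2 * L * d0)"
        using bk by (simp add: field_simps)
      also have "\<dots> \<le> L * e k + 4 * \<Lambda>\<^sup>2 * (2 * L * ((1 + \<Lambda> * H * g) * d))"
        using L K0' by (intro add_left_mono mult_mono inverse_b_le k) (auto simp: d0_def)
      also have "\<dots> = L * e k + m * d" by (simp add: m_def)
      finally show ?thesis .
    qed
    have "e s \<le> \<Gamma> * (h * (L * d) + h * (g * d) + h * (m * d)) * (real s / real s)"
      unfolding \<Gamma>_def
      by (rule stage_gronwall[where w = "\<lambda>k. norm (\<phi> u k - \<phi> v k)", OF h _ _ _ L _ e_le \<phi>_le order_refl])
        (use h L nonneg d_nonneg in \<open>auto simp: e_def\<close>)
    then have es: "e s \<le> \<Gamma> * (L + g + m) * h * d"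
      using two_le_s by (simp add: algebra_simps)
    have "arkc_step F_D F_A s \<eta> h u - arkc_step F_D F_A s \<eta> h v
        = (?K u 0 - ?K v 0) + b s *\<^sub>R (?E u s - ?E v s)"
      unfolding arkc_step_def stage_eq[of F_D F_A h _ s] by (simp add: algebra_simps)
    then have "norm (arkc_step F_D F_A s \<eta> h u - arkc_step F_D F_A s \<eta> h v) \<le> d0 + b s * e s"
      unfolding d0_def e_def using b_pos[of s] by (metis norm_triangle_ineq norm_scaleR abs_of_pos)
    also have "\<dots> \<le> (d + \<Lambda> * g * h * d) + 4 * \<Lambda>\<^sup>2 * (\<Gamma> * (L + g + m) * h * d)"
      using K0 es b_le[of s] by (intro add_mono mult_mono) (auto simp: e_def)
    also have "\<dots> = (1 + C * h) * norm (u - v)"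
      by (simp add: C_def d_def algebra_simps)
    finally show ?thesis .
  qed
  then show ?thesis using nonneg by (intro exI[of _ C]) auto
qed

section \<open>Consistency: the expansion of one step\<close>

text \<open>For \<open>A\<close> the derivative of \<open>f\<close> at \<open>y\<close>, this is the second Taylor polynomial of the solution of
\<open>y' = f(y)\<close>.\<close>

definition taylor2_step :: "('a \<Rightarrow> 'a) \<Rightarrow> ('a \<Rightarrow> 'a) \<Rightarrow> real \<Rightarrow> 'a \<Rightarrow> 'a::real_vector" where
  "taylor2_step f A h y = y + h *\<^sub>R f y + (h\<^sup>2 / 2) *\<^sub>R A (f y)"

text \<open>The derivatives of \<open>F_D\<close> and \<open>F_A\<close> at \<open>y\<close> enter only as linear maps \<open>A_D\<close>, \<open>A_A\<close> with a quadratic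
remainder. Remainders of size \<open>O(h\<^sup>2)\<close> in the stage derivatives suffice, because the convolution
contributes another factor \<open>h\<close>, and the derivative at \<open>y\<close> may therefore replace that at \<open>K\<^sub>0\<close>.
In the proof, \<open>g\<close>, \<open>g1\<close>, \<open>g2\<close> are the constants in the bounds of \<open>G\<close>, of \<open>G\<close> without its
first-order part, and of the error of its second-order expansion; \<open>k1\<close> to \<open>k4\<close> are those for the
stages.\<close>

lemma arkc_step_expansion:
  fixes F_D F_A :: "'a::real_normed_vector \<Rightarrow> 'a"
  assumes lipD: "\<And>u v. norm (F_D u - F_D v) \<le> L * norm (u - v)"
    and lipA: "\<And>u v. norm (F_A u - F_A v) \<le> L * norm (u - v)"
    and pos: "0 \<le> L" "0 \<le> H" "1 \<le> \<Lambda>" "0 \<le> Q" "0 \<le> M"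
  shows "\<exists>C\<ge>0. \<forall>s \<eta> h y A_D A_A. arkc_params s \<eta> \<Lambda> \<longrightarrow> 0 \<le> h \<longrightarrow> h \<le> H \<longrightarrow>
     norm (F_D y) \<le> M \<longrightarrow> norm (F_A y) \<le> M \<longrightarrow> linear A_D \<longrightarrow> linear A_A \<longrightarrow>
     (\<forall>v. norm (A_D v) \<le> L * norm v) \<longrightarrow> (\<forall>v. norm (A_A v) \<le> L * norm v) \<longrightarrow>
     (\<forall>v. norm (F_D (y + v) - F_D y - A_D v) \<le> Q * (norm v)\<^sup>2) \<longrightarrow>
     (\<forall>v. norm (F_A (y + v) - F_A y - A_A v) \<le> Q * (norm v)\<^sup>2) \<longrightarrow>
     norm (arkc_step F_D F_A s \<eta> h y
       - taylor2_step (\<lambda>z. F_D z + F_A z) (\<lambda>v. A_D v + A_A v) h y) \<le> C * h ^ 3"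
proof -
  define M1 where "M1 = M + L * (\<Lambda> * H * M)"
  define g where "g = M + L * (H * M1) + L * (\<Lambda> * H * M)"
  define g1 where "g1 = L * M1 + L * (\<Lambda> * M)"
  define g2 where "g2 = Q * M1\<^sup>2 + L * (L * (\<Lambda> * M)) + Q * (\<Lambda> * M)\<^sup>2"
  define \<Gamma> where "\<Gamma> = 8 * \<Lambda> ^ 3 * exp (8 * \<Lambda>\<^sup>2 * H * L)"
  define k1 where "k1 = \<Gamma> * (M + g)"
  define k2 where "k2 = 8 * \<Lambda>\<^sup>2 * (L * k1)"
  define k3 where "k3 = Q * (\<Lambda> * g + 4 * \<Lambda>\<^sup>2 * k1)\<^sup>2 + Q * (\<Lambda> * g)\<^sup>2"
  define k4 where "k4 = 8 * \<Lambda>\<^sup>2 * (L * k2 + 4 * \<Lambda>\<^sup>2 * k3)"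
  define C where "C = g2 + (1 + \<Lambda>) * (L * g1) + 4 * \<Lambda>\<^sup>2 * k4"
  have M1: "0 \<le> M1" "M \<le> M1" using pos by (auto simp: M1_def)
  then have nonneg: "0 \<le> g" "0 \<le> g1" "0 \<le> g2" "0 \<le> \<Gamma>"
    using pos by (auto simp: g_def g1_def g2_def \<Gamma>_def)
  then have nonneg': "0 \<le> k1" "0 \<le> k2" "0 \<le> k3"
    using pos by (auto simp: k1_def k2_def k3_def)
  then have C0: "0 \<le> C" using pos nonneg by (auto simp: k4_def C_def)
  have "norm (arkc_step F_D F_A s \<eta> h y
       - taylor2_step (\<lambda>z. F_D z + F_A z) (\<lambda>v. A_D v + A_A v) h y) \<le> C * h ^ 3"
    if "arkc_params s \<eta> \<Lambda>" and h: "0 \<le> h" "h \<le> H"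
      and FD: "norm (F_D y) \<le> M" and FA: "norm (F_A y) \<le> M"
      and lin: "linear A_D" "linear A_A"
      and A_D: "\<And>v. norm (A_D v) \<le> L * norm v" and A_A: "\<And>v. norm (A_A v) \<le> L * norm v"
      and remD: "\<And>v. norm (F_D (y + v) - F_D y - A_D v) \<le> Q * (norm v)\<^sup>2"
      and remA: "\<And>v. norm (F_A (y + v) - F_A y - A_A v) \<le> Q * (norm v)\<^sup>2"
    for s \<eta> h y A_D A_A
  proof -
    interpret arkc_params s \<eta> \<Lambda> by fact
    note w = \<omega>2_pos \<omega>2_le_\<Lambda>
    note w2 = \<omega>2_half_bounds
    let ?fD = "F_D y" and ?fA = "F_A y"
    let ?G = "arkc_G F_D F_A s \<eta> h y" and ?K = "arkc_K F_D F_A s \<eta> h y"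
      and ?E = "scaled_increment F_D F_A h y"
    have remD': "norm (F_D (y + v) - F_D y - A_D v) \<le> Q * r\<^sup>2" if "norm v \<le> r" for v r
      using that pos by (intro order_trans[OF remD] mult_left_mono power_mono) auto
    have remA': "norm (F_A (y + v) - F_A y - A_A v) \<le> Q * r\<^sup>2" if "norm v \<le> r" for v r
      using that pos by (intro order_trans[OF remA] mult_left_mono power_mono) auto
    have A_D': "norm (A_D v) \<le> L * r" if "norm v \<le> r" for v r
      using that pos by (intro order_trans[OF A_D] mult_left_mono) auto
    have A_A': "norm (A_A v) \<le> L * r" if "norm v \<le> r" for v r
      using that pos by (intro order_trans[OF A_A] mult_left_mono) auto
    have lipD': "norm (F_D (z + v) - F_D z) \<le> L * r" if "norm v \<le> r" for z v r
      using that pos lipD[of "z + v" z] by (auto intro: order_trans mult_left_mono)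
    have lipA': "norm (F_A (z + v) - F_A z) \<le> L * r" if "norm v \<le> r" for z v r
      using that pos lipA[of "z + v" z] by (auto intro: order_trans mult_left_mono)

    \<comment> \<open>the arguments and values of the evaluations that make up \<open>G\<close>\<close>
    define d1 where "d1 = (\<omega>2 / 2 * h) *\<^sub>R ?fD"
    define a1 where "a1 = F_A (y + d1)"
    define d2 where "d2 = (h / 2) *\<^sub>R (a1 + ?fD)"
    define a2 where "a2 = F_A (y + d2)"
    define d3 where "d3 = ((\<omega>2 - 1) / 2 * h) *\<^sub>R ?fA"
    define a3 where "a3 = F_D (y + d3)"
    have scale: "\<bar>r * h\<bar> \<le> \<Lambda> * h" if "\<bar>r\<bar> \<le> \<Lambda>" for r
      unfolding abs_mult using that h pos by (intro mult_mono) auto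
    have d1: "norm d1 \<le> \<Lambda> * h * M"
      unfolding d1_def by (intro norm_scaleR_le FD scale w2)
    have d3: "norm d3 \<le> \<Lambda> * h * M"
      unfolding d3_def by (intro norm_scaleR_le FA scale w2)
    have hH: "\<Lambda> * h * M \<le> \<Lambda> * H * M" using h pos by (intro mult_right_mono mult_left_mono) auto
    have a1: "norm a1 \<le> M1"
      using norm_triangle_ineq[of ?fA "a1 - ?fA"] FA lipA'[OF order_trans[OF d1 hH], of y]
      by (simp add: a1_def M1_def)
    have "norm (a1 + ?fD) \<le> 2 * M1"
      using norm_triangle_ineq[of a1 ?fD] a1 FD M1 by linarith
    then have d2: "norm d2 \<le> h * M1"
      unfolding d2_def using norm_scaleR_le[of "h / 2" "h / 2" "a1 + ?fD" "2 * M1"] h by simp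
    have Geq: "?G = h *\<^sub>R (a2 + (a3 - ?fD))"
      by (simp add: arkc_G_def Let_def a1_def a2_def a3_def d1_def d2_def d3_def algebra_simps)
    have a2: "norm (a2 - ?fA) \<le> L * (h * M1)"
      unfolding a2_def by (rule lipA'[OF d2])
    have a3: "norm (a3 - ?fD) \<le> L * (\<Lambda> * h * M)"
      unfolding a3_def by (rule lipD'[OF d3])
    have G: "norm ?G \<le> h * g"
    proof -
      have "norm (a2 + (a3 - ?fD)) \<le> norm ?fA + norm (a2 - ?fA) + norm (a3 - ?fD)"
        using norm_triangle_ineq[of a2 "a3 - ?fD"] norm_triangle_ineq[of ?fA "a2 - ?fA"] by simp
      also have "\<dots> \<le> M + L * (H * M1) + L * (\<Lambda> * H * M)"
        using h pos M1 FA hH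
        by (intro add_mono order_trans[OF a2] order_trans[OF a3] mult_left_mono mult_right_mono) auto
      finally show ?thesis unfolding Geq using h by (simp add: g_def mult_left_mono)
    qed
    have G1: "norm (?G - h *\<^sub>R ?fA) \<le> h\<^sup>2 * g1"
    proof -
      have "?G - h *\<^sub>R ?fA = h *\<^sub>R ((a2 - ?fA) + (a3 - ?fD))"
        unfolding Geq by (simp add: algebra_simps)
      then have "norm (?G - h *\<^sub>R ?fA) = h * norm ((a2 - ?fA) + (a3 - ?fD))" using h by simp
      also have "\<dots> \<le> h * (L * (h * M1) + L * (\<Lambda> * h * M))"
        using a2 a3 h by (intro mult_left_mono order_trans[OF norm_triangle_ineq] add_mono) auto
      finally show ?thesis by (simp add: g1_def power2_eq_square algebra_simps)
    qed
    have G2: "norm (?G - h *\<^sub>R ?fA - (h\<^sup>2 / 2) *\<^sub>R A_A (?fA + ?fD) - (h\<^sup>2 * (\<omega>2 - 1) / 2) *\<^sub>R A_D ?fA)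
        \<le> h ^ 3 * g2"
    proof -
      have e1: "norm (a2 - ?fA - A_A d2) \<le> Q * (h * M1)\<^sup>2"
        unfolding a2_def by (rule remA'[OF d2])
      have e3: "norm (a3 - ?fD - A_D d3) \<le> Q * (\<Lambda> * h * M)\<^sup>2"
        unfolding a3_def by (rule remD'[OF d3])
      have e2: "norm (h *\<^sub>R A_A (a1 - ?fA)) \<le> h * (L * (L * (\<Lambda> * h * M)))"
        unfolding a1_def by (rule norm_scaleR_le[OF _ A_A'[OF lipA'[OF d1]]]) (use h in simp)
      have e2': "norm ((1 / 2) *\<^sub>R (h *\<^sub>R A_A (a1 - ?fA))) \<le> h * (L * (L * (\<Lambda> * h * M)))"
        using norm_scaleR_le[OF _ e2, of "1 / 2" 1] by simp
      have Ad2: "A_A d2 = (h / 2) *\<^sub>R A_A (?fA + ?fD) + (1 / 2) *\<^sub>R (h *\<^sub>R A_A (a1 - ?fA))"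
        unfolding d2_def
        by (simp add: linear_scale[OF lin(2)] linear_add[OF lin(2)] linear_diff[OF lin(2)] algebra_simps)
      have Ad3: "A_D d3 = (h * (\<omega>2 - 1) / 2) *\<^sub>R A_D ?fA"
        unfolding d3_def by (simp add: linear_scale[OF lin(1)] mult.commute)
      have "?G - h *\<^sub>R ?fA - (h\<^sup>2 / 2) *\<^sub>R A_A (?fA + ?fD) - (h\<^sup>2 * (\<omega>2 - 1) / 2) *\<^sub>R A_D ?fA
          = h *\<^sub>R ((a2 - ?fA - A_A d2) + (1 / 2) *\<^sub>R (h *\<^sub>R A_A (a1 - ?fA)) + (a3 - ?fD - A_D d3))"
        unfolding Geq Ad2 Ad3 by (simp add: scaleR_right_distrib scaleR_right_diff_distrib power2_eq_square)
      then have "norm (?G - h *\<^sub>R ?fA - (h\<^sup>2 / 2) *\<^sub>R A_A (?fA + ?fD) - (h\<^sup>2 * (\<omega>2 - 1) / 2) *\<^sub>R A_D ?fA)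
          = h * norm ((a2 - ?fA - A_A d2) + (1 / 2) *\<^sub>R (h *\<^sub>R A_A (a1 - ?fA)) + (a3 - ?fD - A_D d3))"
        using h by (simp only: norm_scaleR abs_of_nonneg)
      also have "\<dots> \<le> h * (Q * (h * M1)\<^sup>2 + h * (L * (L * (\<Lambda> * h * M))) + Q * (\<Lambda> * h * M)\<^sup>2)"
        using h e1 e2' e3 by (intro mult_left_mono order_trans[OF norm_triangle_ineq] add_mono) auto
      also have "\<dots> = h ^ 3 * g2"
        by (simp add: g2_def power2_eq_square power3_eq_cube algebra_simps)
      finally show ?thesis .
    qed

    define \<phi> where "\<phi> k = (1 / b k) *\<^sub>R (F_D (?K k) - F_D (?K 0))" for k
    \<comment> \<open>the part of \<open>E\<^sub>k\<close> that is of first order in \<open>h\<close>; the rest is the convolution, \<open>O(h\<^sup>2)\<close>\<close>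
    define E0 where "E0 k = (\<omega>2 * dT k * h) *\<^sub>R ?fD + (S k * \<beta>) *\<^sub>R ?G" for k
    have ker: "0 \<le> 2 * \<omega>2 * h * S k" for k using w h S_nonneg by simp
    have E: "?E j = E0 j + (\<Sum>k\<in>{1..<j}. (2 * \<omega>2 * h * S (j - k)) *\<^sub>R \<phi> k)" for j
      unfolding E0_def \<phi>_def by (rule scaled_increment_representation)
    have \<phi>_le: "norm (\<phi> k) \<le> L * norm (?E k)" for k
    proof -
      have "norm (F_D (?K k) - F_D (?K 0)) \<le> L * (b k * norm (?E k))"
        unfolding stage_eq[of F_D F_A h y k] using b_pos[of k] by (intro lipD') simp
      then have "norm (\<phi> k) \<le> 1 / b k * (L * (b k * norm (?E k)))"
        unfolding \<phi>_def using b_pos[of k] by (intro norm_scaleR_le) auto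
      then show ?thesis using b_pos[of k] by simp
    qed
    have "norm (?E j) \<le> \<omega>2 * dT j * (h * M) + S j * \<bar>\<beta>\<bar> * (h * g)
        + (\<Sum>k\<in>{1..<j}. 2 * \<omega>2 * h * S (j - k) * norm (\<phi> k))" for j
    proof -
      have "norm (?E j) \<le> (\<omega>2 * dT j * h) * M + S j * \<bar>\<beta>\<bar> * (h * g)
          + (\<Sum>k\<in>{1..<j}. 2 * \<omega>2 * h * S (j - k) * norm (\<phi> k))"
        unfolding E E0_def
      proof (intro norm_add3_le norm_scaleR_le FD G)
        show "norm (\<Sum>k\<in>{1..<j}. (2 * \<omega>2 * h * S (j - k)) *\<^sub>R \<phi> k)
            \<le> (\<Sum>k\<in>{1..<j}. 2 * \<omega>2 * h * S (j - k) * norm (\<phi> k))"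
          using ker by (intro order_trans[OF norm_sum] sum_mono norm_scaleR_le) auto
      qed (use w h dT_nonneg[of j] S_nonneg[of j] in \<open>auto simp: abs_mult\<close>)
      then show ?thesis by (simp only: mult.assoc)
    qed
    then have "norm (?E j) \<le> \<Gamma> * (h * M + h * g + h * 0) * (real j / real s)" if "j \<le> s" for j
      unfolding \<Gamma>_def using h pos nonneg that \<phi>_le
      by (intro stage_gronwall[where w = "\<lambda>k. norm (\<phi> k)" and L = L]) auto
    moreover have "\<Gamma> * (h * M + h * g + h * 0) * (real j / real s) \<le> \<Gamma> * (h * M + h * g + h * 0) * 1"
      if "j \<le> s" for j
      using that h pos nonneg two_le_s by (intro mult_left_mono) auto
    ultimately have E1: "norm (?E j) \<le> h * k1" if "j \<le> s" for j
      using that unfolding k1_def by (fastforce simp: algebra_simps)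

    have sum_le: "norm (\<Sum>k\<in>{1..<j}. (2 * \<omega>2 * h * S (j - k)) *\<^sub>R v k) \<le> 8 * \<Lambda>\<^sup>2 * h * B"
      if "j \<le> s" "\<And>k. k < j \<Longrightarrow> norm (v k) \<le> B" "0 \<le> B" for v :: "nat \<Rightarrow> 'a" and B j
    proof -
      have "norm (\<Sum>k\<in>{1..<j}. (2 * \<omega>2 * h * S (j - k)) *\<^sub>R v k)
          \<le> (\<Sum>k\<in>{1..<j}. 2 * \<omega>2 * h * S (j - k) * B)"
        using ker that by (intro order_trans[OF norm_sum] sum_mono norm_scaleR_le) auto
      also have "\<dots> \<le> 8 * \<Lambda>\<^sup>2 * h * B"
        unfolding sum_distrib_right[symmetric] using kernel_sum_le that h by (intro mult_right_mono) auto
      finally show ?thesis .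
    qed
    have E2: "norm (?E k - E0 k) \<le> h\<^sup>2 * k2" if "k \<le> s" for k
    proof -
      have "norm (\<phi> i) \<le> L * (h * k1)" if "i < k" for i
        using that \<open>k \<le> s\<close> E1[of i] pos by (intro order_trans[OF \<phi>_le] mult_left_mono) auto
      moreover have "?E k - E0 k = (\<Sum>i\<in>{1..<k}. (2 * \<omega>2 * h * S (k - i)) *\<^sub>R \<phi> i)"
        using E[of k] by simp
      ultimately have "norm (?E k - E0 k) \<le> 8 * \<Lambda>\<^sup>2 * h * (L * (h * k1))"
        using that h pos nonneg' sum_le[of k \<phi> "L * (h * k1)"] by simp
      then show ?thesis by (simp add: k2_def power2_eq_square mult_ac)
    qed
    \<comment> \<open>the error of linearizing the stage derivatives at \<open>y\<close>\<close>
    define r where "r k = \<phi> k - A_D (?E k)" for k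
    have r: "norm (r k) \<le> 4 * \<Lambda>\<^sup>2 * (h\<^sup>2 * k3)" if k: "k \<le> s" for k
    proof -
      define P where "P = (\<omega>2 / 2) *\<^sub>R ?G"
      define D where "D = b k *\<^sub>R ?E k"
      have P: "norm P \<le> \<Lambda> * (h * g)" unfolding P_def by (rule norm_scaleR_le[OF w2(1) G])
      have "norm D \<le> 4 * \<Lambda>\<^sup>2 * (h * k1)"
        unfolding D_def using b_pos[of k] b_le[OF k] E1[OF k] by (intro norm_scaleR_le) auto
      then have PD: "norm (P + D) \<le> \<Lambda> * (h * g) + 4 * \<Lambda>\<^sup>2 * (h * k1)"
        using P by (intro order_trans[OF norm_triangle_ineq] add_mono)
      have K: "?K 0 = y + P" "?K k = y + (P + D)"
        unfolding stage_eq[of F_D F_A h y k] by (simp_all add: P_def D_def)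
      \<comment> \<open>a difference of two remainders at \<open>y\<close>, each of size \<open>O(h\<^sup>2)\<close>\<close>
      have "b k *\<^sub>R r k = F_D (y + (P + D)) - F_D (y + P) - A_D D"
        unfolding r_def \<phi>_def K scaleR_right_diff_distrib D_def
        using b_pos[of k] by (simp add: linear_scale[OF lin(1)] algebra_simps)
      also have "\<dots> = (F_D (y + (P + D)) - ?fD - A_D (P + D)) - (F_D (y + P) - ?fD - A_D P)"
        by (simp add: linear_add[OF lin(1)])
      also have "norm \<dots> \<le> Q * (\<Lambda> * (h * g) + 4 * \<Lambda>\<^sup>2 * (h * k1))\<^sup>2 + Q * (\<Lambda> * (h * g))\<^sup>2"
        using remD'[OF P] remD'[OF PD]
          norm_triangle_ineq4[of "F_D (y + (P + D)) - ?fD - A_D (P + D)" "F_D (y + P) - ?fD - A_D P"]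
        by linarith
      also have "\<dots> = h\<^sup>2 * k3" by (simp add: k3_def power2_eq_square algebra_simps)
      finally have br: "norm (b k *\<^sub>R r k) \<le> h\<^sup>2 * k3" .
      have "norm ((1 / b k) *\<^sub>R (b k *\<^sub>R r k)) \<le> 4 * \<Lambda>\<^sup>2 * (h\<^sup>2 * k3)"
        by (rule norm_scaleR_le[OF _ br]) (use b_pos[of k] inverse_b_le[OF k] in simp)
      then show ?thesis using b_pos[of k] by simp
    qed
    define R where "R = (\<Sum>k\<in>{1..<s}. (2 * \<omega>2 * h * S (s - k)) *\<^sub>R (A_D (?E k - E0 k) + r k))"
    have R: "norm R \<le> h ^ 3 * k4"
    proof -
      have "norm (A_D (?E k - E0 k) + r k) \<le> L * (h\<^sup>2 * k2) + 4 * \<Lambda>\<^sup>2 * (h\<^sup>2 * k3)" if "k < s" for k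
        using that r[of k] A_D'[OF E2, of k] by (intro order_trans[OF norm_triangle_ineq] add_mono) auto
      then have "norm R \<le> 8 * \<Lambda>\<^sup>2 * h * (L * (h\<^sup>2 * k2) + 4 * \<Lambda>\<^sup>2 * (h\<^sup>2 * k3))"
        unfolding R_def using pos nonneg' by (intro sum_le) auto
      then show ?thesis by (simp add: k4_def power2_eq_square power3_eq_cube algebra_simps)
    qed
    \<comment> \<open>the two sums are those of the second-order conditions\<close>
    have main: "(\<Sum>k\<in>{1..<s}. (2 * \<omega>2 * h * S (s - k)) *\<^sub>R A_D (E0 k))
        = (h\<^sup>2 * (\<Sum>k\<in>{1..<s}. 2 * \<omega>2 * S (s - k) * (\<omega>2 * dT k))) *\<^sub>R A_D ?fD
          + (h * (\<Sum>k\<in>{1..<s}. 2 * \<omega>2 * S (s - k) * (S k * \<beta>))) *\<^sub>R A_D ?G"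
      unfolding E0_def sum_distrib_left scaleR_sum_left linear_add[OF lin(1)] linear_scale[OF lin(1)]
        scaleR_right_distrib sum.distrib scaleR_scaleR
      by (simp only: power2_eq_square mult_ac)
    have \<phi>_split: "\<phi> k = A_D (E0 k) + (A_D (?E k - E0 k) + r k)" for k
      by (simp add: r_def linear_diff[OF lin(1)])
    have Es: "?E s = E0 s + (\<Sum>k\<in>{1..<s}. (2 * \<omega>2 * h * S (s - k)) *\<^sub>R A_D (E0 k)) + R"
      unfolding R_def E[of s] \<phi>_split[abs_def] scaleR_right_distrib sum.distrib by (simp only: add.assoc)
    have bE: "b s *\<^sub>R ?E s = h *\<^sub>R ?fD + (1 - \<omega>2 / 2) *\<^sub>R ?G
        + ((h\<^sup>2 / 2) *\<^sub>R A_D ?fD + (h * (1 - \<omega>2 / 2)) *\<^sub>R A_D ?G) + b s *\<^sub>R R"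
    proof -
      have c: "b s * (\<omega>2 * dT s * h) = h" "b s * (S s * \<beta>) = 1 - \<omega>2 / 2"
        "b s * (h\<^sup>2 * (\<Sum>k\<in>{1..<s}. 2 * \<omega>2 * S (s - k) * (\<omega>2 * dT k))) = h\<^sup>2 / 2"
        "b s * (h * (\<Sum>k\<in>{1..<s}. 2 * \<omega>2 * S (s - k) * (S k * \<beta>))) = h * (1 - \<omega>2 / 2)"
        using order1_D order1_G order2_D order2_G by algebra+
      show ?thesis
        unfolding Es[unfolded main] E0_def scaleR_right_distrib scaleR_scaleR c ..
    qed
    define G' where "G' = ?G - h *\<^sub>R ?fA"
    define G'' where "G'' = ?G - h *\<^sub>R ?fA - (h\<^sup>2 / 2) *\<^sub>R A_A (?fA + ?fD) - (h\<^sup>2 * (\<omega>2 - 1) / 2) *\<^sub>R A_D ?fA"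
    have "arkc_step F_D F_A s \<eta> h y = y + (\<omega>2 / 2) *\<^sub>R ?G + b s *\<^sub>R ?E s"
      unfolding arkc_step_def stage_eq[of F_D F_A h y s] by simp
    also have "\<dots> = y + ?G + h *\<^sub>R ?fD + (h\<^sup>2 / 2) *\<^sub>R A_D ?fD + (h * (1 - \<omega>2 / 2)) *\<^sub>R A_D ?G + b s *\<^sub>R R"
      unfolding bE by (simp add: algebra_simps)
    also have "\<dots> = taylor2_step (\<lambda>z. F_D z + F_A z) (\<lambda>v. A_D v + A_A v) h y
        + (G'' + (h * (1 - \<omega>2 / 2)) *\<^sub>R A_D G' + b s *\<^sub>R R)"
    proof -
      have G: "?G = h *\<^sub>R ?fA + G'" "A_D ?G = h *\<^sub>R A_D ?fA + A_D G'"
        by (simp_all add: G'_def linear_diff[OF lin(1)] linear_scale[OF lin(1)])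
      have "G' = G'' + (h\<^sup>2 / 2) *\<^sub>R A_A (?fA + ?fD) + (h\<^sup>2 * (\<omega>2 - 1) / 2) *\<^sub>R A_D ?fA"
        by (simp add: G'_def G''_def)
      \<comment> \<open>the two sources of \<open>A_D F_A(y)\<close> add up to the coefficient \<open>1/2\<close>\<close>
      moreover have "(h\<^sup>2 * (\<omega>2 - 1) / 2) *\<^sub>R A_D ?fA + (h * (1 - \<omega>2 / 2)) *\<^sub>R (h *\<^sub>R A_D ?fA)
          = (h\<^sup>2 / 2) *\<^sub>R A_D ?fA"
        by (simp add: power2_eq_square field_simps flip: scaleR_left_distrib)
      ultimately show ?thesis
        unfolding G taylor2_step_def linear_add[OF lin(1)] linear_add[OF lin(2)] scaleR_right_distrib
        by (simp add: add_ac linear_scale[OF lin(1)])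
    qed
    finally have "norm (arkc_step F_D F_A s \<eta> h y
        - taylor2_step (\<lambda>z. F_D z + F_A z) (\<lambda>v. A_D v + A_A v) h y)
        = norm (G'' + (h * (1 - \<omega>2 / 2)) *\<^sub>R A_D G' + b s *\<^sub>R R)" by simp
    also have "\<dots> \<le> h ^ 3 * g2 + h * (1 + \<Lambda>) * (L * (h\<^sup>2 * g1)) + 4 * \<Lambda>\<^sup>2 * (h ^ 3 * k4)"
    proof (intro order_trans[OF norm_triangle_ineq] add_mono)
      show "norm G'' \<le> h ^ 3 * g2" unfolding G''_def by (rule G2)
      show "norm ((h * (1 - \<omega>2 / 2)) *\<^sub>R A_D G') \<le> h * (1 + \<Lambda>) * (L * (h\<^sup>2 * g1))"
        unfolding G'_def using h w2 by (intro norm_scaleR_le A_D' G1) (simp add: abs_mult mult_left_mono)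
      show "norm (b s *\<^sub>R R) \<le> 4 * \<Lambda>\<^sup>2 * (h ^ 3 * k4)"
        using b_pos[of s] b_le[of s] by (intro norm_scaleR_le R) auto
    qed
    also have "\<dots> = C * h ^ 3"
      by (simp add: C_def power2_eq_square power3_eq_cube algebra_simps)
    finally show ?thesis .
  qed
  then show ?thesis using C0 by (intro exI[of _ C]) auto
qed

section \<open>The exact solution\<close>

lemma vector_derivative_bound:
  fixes g :: "real \<Rightarrow> 'a::real_normed_vector"
  assumes der: "\<And>t. t \<in> {a..b} \<Longrightarrow> (g has_vector_derivative g' t) (at t within {a..b})"
    and bound: "\<And>t. t \<in> {a..b} \<Longrightarrow> norm (g' t) \<le> B"
    and t: "t \<in> {a..b}"
  shows "norm (g t - g a) \<le> B * (t - a)"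
proof -
  have "norm (g t - g a) \<le> B * norm (t - a)"
  proof (rule differentiable_bound[of "{a..b}" g "\<lambda>t r. r *\<^sub>R g' t"])
    show "onorm (\<lambda>r. r *\<^sub>R g' u) \<le> B" if "u \<in> {a..b}" for u
      using bound[OF that] by (intro onorm_le) (simp add: mult.commute[of B] mult_left_mono)
  qed (use der t in \<open>auto simp: has_vector_derivative_def\<close>)
  then show ?thesis using t by simp
qed

text \<open>The Taylor remainder is bounded through its derivative, \<open>f(y(t)) - f(y(a)) - (t - a) A f(y(a))\<close>,
which is \<open>O(h\<^sup>2)\<close> by linearizing \<open>f\<close> and then \<open>y\<close>. A third derivative of \<open>y\<close>, with the chain rule
for \<open>f'(y) f(y)\<close>, is thereby avoided.\<close>

lemma solution_expansion:
  fixes y :: "real \<Rightarrow> 'a::real_normed_vector"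
  assumes sol: "\<And>t. t \<in> {a..b} \<Longrightarrow> (y has_vector_derivative f (y t)) (at t within {a..b})"
    and ab: "a \<le> b" and pos: "0 \<le> L" "0 \<le> Q" "0 \<le> M"
    and M: "\<And>t. t \<in> {a..b} \<Longrightarrow> norm (f (y t)) \<le> M"
    and lip: "\<And>u v. norm (f u - f v) \<le> L * norm (u - v)"
    and A: "\<And>v. norm (A v) \<le> L * norm v" "linear A"
    and rem: "\<And>v. norm (f (y a + v) - f (y a) - A v) \<le> Q * (norm v)\<^sup>2"
  shows "norm (y b - taylor2_step f A (b - a) (y a)) \<le> (Q * M\<^sup>2 + L\<^sup>2 * M) * (b - a) ^ 3"
proof -
  define h where "h = b - a"
  have h: "0 \<le> h" using ab by (simp add: h_def)
  have th: "0 \<le> t - a" "t - a \<le> h" if "t \<in> {a..b}" for t using that by (auto simp: h_def)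
  have \<Delta>: "norm (y t - y a) \<le> M * h" if t: "t \<in> {a..b}" for t
    using vector_derivative_bound[OF sol M t] mult_left_mono[OF th(2)[OF t] pos(3)] by linarith
  have lin: "norm (y t - y a - (t - a) *\<^sub>R f (y a)) \<le> L * (M * h) * h" if t: "t \<in> {a..b}" for t
  proof -
    let ?g = "\<lambda>t. y t - (t - a) *\<^sub>R f (y a)"
    have "norm (?g t - ?g a) \<le> L * (M * h) * (t - a)"
    proof (rule vector_derivative_bound[OF _ _ t])
      show "(?g has_vector_derivative (f (y u) - f (y a))) (at u within {a..b})" if "u \<in> {a..b}" for u
        by (auto intro!: derivative_eq_intros sol that)
      show "norm (f (y u) - f (y a)) \<le> L * (M * h)" if "u \<in> {a..b}" for u
        using \<Delta>[OF that] pos by (intro order_trans[OF lip] mult_left_mono)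
    qed
    also have "\<dots> \<le> L * (M * h) * h" using th[OF t] h pos by (intro mult_left_mono) auto
    finally show ?thesis by (simp add: algebra_simps)
  qed
  let ?g = "\<lambda>t. y t - (t - a) *\<^sub>R f (y a) - ((t - a)\<^sup>2 / 2) *\<^sub>R A (f (y a))"
  have "norm (?g b - ?g a) \<le> (Q * (M * h)\<^sup>2 + L * (L * (M * h) * h)) * (b - a)"
  proof (rule vector_derivative_bound)
    fix u assume u: "u \<in> {a..b}"
    show "(?g has_vector_derivative (f (y u) - f (y a) - (u - a) *\<^sub>R A (f (y a)))) (at u within {a..b})"
      by (auto intro!: derivative_eq_intros sol u)
    have "f (y u) - f (y a) - (u - a) *\<^sub>R A (f (y a))
        = (f (y a + (y u - y a)) - f (y a) - A (y u - y a)) + A (y u - y a - (u - a) *\<^sub>R f (y a))"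
      by (simp add: linear_diff[OF A(2)] linear_scale[OF A(2)])
    also have "norm \<dots> \<le> Q * (M * h)\<^sup>2 + L * (L * (M * h) * h)"
      using \<Delta>[OF u] lin[OF u] pos
      by (intro order_trans[OF norm_triangle_ineq] add_mono order_trans[OF rem] order_trans[OF A(1)]
          mult_left_mono power_mono) auto
    finally show "norm (f (y u) - f (y a) - (u - a) *\<^sub>R A (f (y a))) \<le> Q * (M * h)\<^sup>2 + L * (L * (M * h) * h)" .
  qed (use ab in auto)
  moreover have "?g b - ?g a = y b - taylor2_step f A (b - a) (y a)"
    by (simp add: taylor2_step_def algebra_simps)
  moreover have "(Q * (M * h)\<^sup>2 + L * (L * (M * h) * h)) * h = (Q * M\<^sup>2 + L\<^sup>2 * M) * h ^ 3"
    by (simp add: power2_eq_square power3_eq_cube algebra_simps)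
  ultimately show ?thesis unfolding h_def[symmetric] by (simp only:)
qed

lemma C2_quadratic_remainder:
  fixes F :: "'a::real_normed_vector \<Rightarrow> 'b::real_normed_vector"
  assumes C2: "C2_with_derivs F F' F''" and B: "\<And>x. norm (F'' x) \<le> B"
  shows "norm (F (x + v) - F x - F' x v) \<le> B * (norm v)\<^sup>2"
proof -
  have F: "(F has_derivative blinfun_apply (F' u)) (at u)"
    and F': "(F' has_derivative blinfun_apply (F'' u)) (at u)" for u
    using C2 by (auto simp: C2_with_derivs_def)
  have B0: "0 \<le> B" using B[of 0] norm_ge_zero order_trans by blast
  have lip: "norm (F' u - F' x) \<le> B * norm (u - x)" for u
    by (rule differentiable_bound[of UNIV F' "\<lambda>u. blinfun_apply (F'' u)"])
      (use F' B in \<open>auto simp flip: norm_blinfun.rep_eq\<close>)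
  let ?S = "closed_segment x (x + v)"
  have "norm (F (x + v) - F x - F' x (x + v - x)) \<le> norm (x + v - x) * (B * norm v)"
  proof (rule differentiable_bound_linearization[of x "x + v" ?S F "\<lambda>u. blinfun_apply (F' u)" x])
    show "x + t *\<^sub>R (x + v - x) \<in> ?S" if "t \<in> {0..1}" for t
      using that by (auto simp: in_segment algebra_simps intro!: exI[of _ t])
    show "(F has_derivative blinfun_apply (F' u)) (at u within ?S)" for u
      using F by (rule has_derivative_at_withinI)
    show "onorm (blinfun_apply (F' u) - blinfun_apply (F' x)) \<le> B * norm v" if "u \<in> ?S" for u
    proof -
      have "onorm (blinfun_apply (F' u) - blinfun_apply (F' x)) = norm (F' u - F' x)"
        by (simp add: norm_blinfun.rep_eq minus_blinfun.rep_eq fun_diff_def)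
      also have "\<dots> \<le> B * norm (u - x)" by (rule lip)
      also have "\<dots> \<le> B * norm v"
        using segment_bound1[OF that] B0 by (intro mult_left_mono) (auto simp: norm_minus_commute)
      finally show ?thesis .
    qed
  qed auto
  then show ?thesis by (simp add: power2_eq_square mult_ac)
qed

section \<open>Convergence\<close>

lemma is_norm_le_euclidean:
  fixes nrm :: "'a::euclidean_space \<Rightarrow> real"
  assumes "is_norm nrm"
  shows "\<exists>c\<ge>0. \<forall>x. nrm x \<le> c * norm x"
proof (intro exI conjI allI)
  have nn: "0 \<le> nrm x" and hom: "nrm (c *\<^sub>R x) = \<bar>c\<bar> * nrm x" and tri: "nrm (x + z) \<le> nrm x + nrm z" for x z c
    using assms by (auto simp: is_norm_def)
  show "0 \<le> (\<Sum>i\<in>Basis. nrm i)" using nn by (intro sum_nonneg)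
  fix x :: 'a
  have sum_le: "nrm (\<Sum>i\<in>B. f i) \<le> (\<Sum>i\<in>B. nrm (f i))" if "finite B" for B :: "'a set" and f
    using that
  proof induction
    case empty
    then show ?case using hom[of 0 0] by simp
  next
    case (insert i B)
    then show ?case using tri[of "f i" "sum f B"] by simp
  qed
  have "nrm x = nrm (\<Sum>i\<in>Basis. (x \<bullet> i) *\<^sub>R i)" by (simp add: euclidean_representation)
  also have "\<dots> \<le> (\<Sum>i\<in>Basis. \<bar>x \<bullet> i\<bar> * nrm i)" using sum_le[of Basis "\<lambda>i. (x \<bullet> i) *\<^sub>R i"] by (simp add: hom)
  also have "\<dots> \<le> (\<Sum>i\<in>Basis. norm x * nrm i)" using nn by (intro sum_mono mult_right_mono Basis_le_norm)
  finally show "nrm x \<le> (\<Sum>i\<in>Basis. nrm i) * norm x" by (simp add: sum_distrib_left mult.commute)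
qed

text \<open>The factor \<open>(1 + q) ^ n\<close> is a crude but sufficient bound for each of the \<open>n\<close> powers of \<open>1 + q\<close> by which
the individual errors \<open>d\<close> are amplified.\<close>

lemma one_step_error_accumulation:
  fixes e :: "nat \<Rightarrow> real"
  assumes "e 0 = 0" "0 \<le> q" "0 \<le> d" "\<And>n. n < N \<Longrightarrow> e (Suc n) \<le> (1 + q) * e n + d" "n \<le> N"
  shows "e n \<le> real n * d * (1 + q) ^ n"
  using \<open>n \<le> N\<close>
proof (induction n)
  case (Suc n)
  have "e (Suc n) \<le> (1 + q) * e n + d"
    using Suc.prems by (intro assms(4)) simp
  also have "\<dots> \<le> (1 + q) * (real n * d * (1 + q) ^ n) + d"
    using Suc assms(2) by (intro add_right_mono mult_left_mono) auto
  also have "\<dots> \<le> (1 + q) * (real n * d * (1 + q) ^ n) + d * (1 + q) ^ Suc n"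
    using assms mult_left_mono[OF one_le_power[of "1 + q" "Suc n"], of d] by simp
  finally show ?case by (simp add: algebra_simps)
qed (use assms in simp)

theorem theorem4p3:
  fixes nrm :: "real ^ 'd \<Rightarrow> real"
    and F_D F_A :: "real ^ 'd \<Rightarrow> real ^ 'd"
    and F_D' F_A' :: "real ^ 'd \<Rightarrow> (real ^ 'd) \<Rightarrow>\<^sub>L (real ^ 'd)"
    and F_D'' F_A'' :: "real ^ 'd \<Rightarrow> (real ^ 'd) \<Rightarrow>\<^sub>L ((real ^ 'd) \<Rightarrow>\<^sub>L (real ^ 'd))"
    and y :: "real \<Rightarrow> real ^ 'd"
    and y0 :: "real ^ 'd"
    and T :: real
    and s :: "nat \<Rightarrow> nat"
    and \<eta> :: "nat \<Rightarrow> real"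
    and \<eta>max :: real
  assumes nrm: "is_norm nrm"
    and T: "T > 0"
    and C2_D: "C2_with_derivs F_D F_D' F_D''"
    and C2_A: "C2_with_derivs F_A F_A' F_A''"
    and lipschitz_D: "\<exists>L. L-lipschitz_on UNIV F_D"
    and lipschitz_A: "\<exists>L. L-lipschitz_on UNIV F_A"
    and bounded_D: "bounded (range F_D')" "bounded (range F_D'')"
    and bounded_A: "bounded (range F_A')" "bounded (range F_A'')"
    and solution: "\<And>t. t \<in> {0..T} \<Longrightarrow>
                     (y has_vector_derivative (F_D (y t) + F_A (y t))) (at t within {0..T})"
    and initial: "y 0 = y0"
    and stages: "\<And>N. N \<ge> 1 \<Longrightarrow> s N \<ge> 2"
    and damping: "\<And>N. N \<ge> 1 \<Longrightarrow> 0 \<le> \<eta> N \<and> \<eta> N \<le> \<eta>max"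
  shows "\<exists>C. \<forall>N\<ge>1. \<forall>n\<in>{1..N}.
           (let h = T / real N in
            nrm (y (real n * h) - arkc F_D F_A (s N) (\<eta> N) h y0 n) \<le> C * h\<^sup>2)"
proof -
  define \<Lambda> where "\<Lambda> = exp (2 * \<eta>max)"
  have params: "arkc_params (s N) (\<eta> N) \<Lambda>" if "N \<ge> 1" for N
    using stages[OF that] damping[OF that] by (simp add: arkc_params_def \<Lambda>_def)
  have \<Lambda>: "1 \<le> \<Lambda>" using arkc_params.\<Lambda>_ge_1[OF params[of 1]] by simp
  obtain L1 L2 where L12: "L1-lipschitz_on UNIV F_D" "L2-lipschitz_on UNIV F_A"
    using lipschitz_D lipschitz_A by auto
  obtain L3 L4 where L34: "\<And>x. norm (F_D' x) \<le> L3" "\<And>x. norm (F_A' x) \<le> L4"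
    using bounded_D(1) bounded_A(1) unfolding bounded_iff by auto
  define L where "L = Max {L1, L2, L3, L4}"
  have LL: "L1 \<le> L" "L2 \<le> L" "L3 \<le> L" "L4 \<le> L" by (auto simp: L_def)
  have L: "0 \<le> L" using L12(1) LL lipschitz_on_nonneg by fastforce
  have lipD: "norm (F_D u - F_D v) \<le> L * norm (u - v)" for u v
    using lipschitz_on_normD[OF L12(1), of u v] LL mult_right_mono[of L1 L "norm (u - v)"] by simp
  have lipA: "norm (F_A u - F_A v) \<le> L * norm (u - v)" for u v
    using lipschitz_on_normD[OF L12(2), of u v] LL mult_right_mono[of L2 L "norm (u - v)"] by simp
  have F_D': "norm (F_D' x v) \<le> L * norm v" for x v
    by (intro order_trans[OF norm_blinfun] mult_right_mono order_trans[OF L34(1) LL(3)]) auto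
  have F_A': "norm (F_A' x v) \<le> L * norm v" for x v
    by (intro order_trans[OF norm_blinfun] mult_right_mono order_trans[OF L34(2) LL(4)]) auto
  obtain Q1 Q2 where Q12: "\<And>x. norm (F_D'' x) \<le> Q1" "\<And>x. norm (F_A'' x) \<le> Q2"
    using bounded_D(2) bounded_A(2) unfolding bounded_iff by auto
  define Q where "Q = max Q1 Q2"
  have QQ: "norm (F_D'' x) \<le> Q" "norm (F_A'' x) \<le> Q" for x using Q12[of x] by (auto simp: Q_def)
  have Q: "0 \<le> Q" using QQ(1)[of 0] norm_ge_zero order_trans by blast
  note remD = C2_quadratic_remainder[OF C2_D QQ(1)] and remA = C2_quadratic_remainder[OF C2_A QQ(2)]

  have cont: "continuous_on {0..T} y"
    unfolding continuous_on_eq_continuous_within by (blast intro: has_vector_derivative_continuous solution)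
  have contF: "continuous_on UNIV F_D" "continuous_on UNIV F_A"
    using L12 lipschitz_on_continuous_on by auto
  have "bounded ((\<lambda>t. F (y t)) ` {0..T})" if "continuous_on UNIV F" for F :: "real ^ 'd \<Rightarrow> real ^ 'd"
    by (intro compact_imp_bounded compact_continuous_image continuous_on_compose2[OF that cont]) auto
  from this[OF contF(1)] this[OF contF(2)] obtain M1 M2 where
    M12: "\<forall>t\<in>{0..T}. norm (F_D (y t)) \<le> M1" "\<forall>t\<in>{0..T}. norm (F_A (y t)) \<le> M2"
    unfolding bounded_iff by (metis image_eqI)
  define M where "M = max M1 M2"
  have MM: "norm (F_D (y t)) \<le> M" "norm (F_A (y t)) \<le> M" if "t \<in> {0..T}" for t
    using M12 that by (auto simp: M_def le_max_iff_disj)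
  have M: "0 \<le> M" using order_trans[OF norm_ge_zero MM(1)[of 0]] T by simp

  \<comment> \<open>the step size is at most \<open>T\<close>, so \<open>T\<close> serves as the bound on \<open>h\<close>\<close>
  obtain C1 where C1: "0 \<le> C1" and stable: "\<And>s \<eta> h u v. arkc_params s \<eta> \<Lambda> \<Longrightarrow> 0 \<le> h \<Longrightarrow> h \<le> T \<Longrightarrow>
      norm (arkc_step F_D F_A s \<eta> h u - arkc_step F_D F_A s \<eta> h v) \<le> (1 + C1 * h) * norm (u - v)"
    using arkc_step_lipschitz[where F_D = F_D and F_A = F_A and L = L and H = T and \<Lambda> = \<Lambda>, OF lipD lipA L _ \<Lambda>] T by auto
  obtain C2 where C2: "0 \<le> C2" and consistent: "\<forall>s \<eta> h y A_D A_A. arkc_params s \<eta> \<Lambda> \<longrightarrow> 0 \<le> h \<longrightarrow> h \<le> T \<longrightarrow>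
     norm (F_D y) \<le> M \<longrightarrow> norm (F_A y) \<le> M \<longrightarrow> linear A_D \<longrightarrow> linear A_A \<longrightarrow>
     (\<forall>v. norm (A_D v) \<le> L * norm v) \<longrightarrow> (\<forall>v. norm (A_A v) \<le> L * norm v) \<longrightarrow>
     (\<forall>v. norm (F_D (y + v) - F_D y - A_D v) \<le> Q * (norm v)\<^sup>2) \<longrightarrow>
     (\<forall>v. norm (F_A (y + v) - F_A y - A_A v) \<le> Q * (norm v)\<^sup>2) \<longrightarrow>
     norm (arkc_step F_D F_A s \<eta> h y
       - taylor2_step (\<lambda>z. F_D z + F_A z) (\<lambda>v. A_D v + A_A v) h y) \<le> C2 * h ^ 3"
    using arkc_step_expansion[where F_D = F_D and F_A = F_A and L = L and H = T and \<Lambda> = \<Lambda> and Q = Q and M = M,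
        OF lipD lipA L _ \<Lambda> Q M] T by auto
  \<comment> \<open>the sum field has Lipschitz constant \<open>2 L\<close>, remainder constant \<open>2 Q\<close> and bound \<open>2 M\<close>\<close>
  define C3 where "C3 = C2 + (2 * Q * (2 * M)\<^sup>2 + (2 * L)\<^sup>2 * (2 * M))"
  have C3: "0 \<le> C3" using C2 Q M by (simp add: C3_def)
  have local: "norm (arkc_step F_D F_A (s N) (\<eta> N) h (y t) - y (t + h)) \<le> C3 * h ^ 3"
    if N: "N \<ge> 1" and t: "0 \<le> t" "t + h \<le> T" and h: "0 \<le> h" for N t h
  proof -
    let ?f = "\<lambda>z. F_D z + F_A z" and ?A = "\<lambda>v. F_D' (y t) v + F_A' (y t) v"
    have tT: "t \<in> {0..T}" using t h by auto
    have 1: "norm (arkc_step F_D F_A (s N) (\<eta> N) h (y t) - taylor2_step ?f ?A h (y t)) \<le> C2 * h ^ 3"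
      using t h by (intro consistent[rule_format] params N MM tT F_D' F_A' remD remA)
        (auto intro: bounded_linear.linear blinfun.bounded_linear_right)
    have "norm (y (t + h) - taylor2_step ?f ?A (t + h - t) (y t))
        \<le> (2 * Q * (2 * M)\<^sup>2 + (2 * L)\<^sup>2 * (2 * M)) * (t + h - t) ^ 3"
    proof (rule solution_expansion)
      show "(y has_vector_derivative ?f (y u)) (at u within {t..t + h})" if "u \<in> {t..t + h}" for u
        by (rule has_vector_derivative_within_subset[OF solution]) (use that t h in auto)
      show "norm (?f (y u)) \<le> 2 * M" if "u \<in> {t..t + h}" for u
        using norm_triangle_ineq[of "F_D (y u)" "F_A (y u)"] MM[of u] that t by auto
      show "norm (?f u - ?f v) \<le> 2 * L * norm (u - v)" for u v
        using norm_diff_triangle_ineq[of "F_D u" "F_A u" "F_D v" "F_A v"] lipD[of u v] lipA[of u v] by auto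
      show "norm (?A v) \<le> 2 * L * norm v" for v
        using norm_triangle_ineq[of "F_D' (y t) v" "F_A' (y t) v"] F_D'[of "y t" v] F_A'[of "y t" v] by auto
      show "linear ?A" by (intro linear_compose_add bounded_linear.linear blinfun.bounded_linear_right)
      show "norm (?f (y t + v) - ?f (y t) - ?A v) \<le> 2 * Q * (norm v)\<^sup>2" for v
      proof -
        have split: "?f (y t + v) - ?f (y t) - ?A v = (F_D (y t + v) - F_D (y t) - F_D' (y t) v)
            + (F_A (y t + v) - F_A (y t) - F_A' (y t) v)" by simp
        show ?thesis
          unfolding split
          using norm_triangle_ineq[of "F_D (y t + v) - F_D (y t) - F_D' (y t) v"
              "F_A (y t + v) - F_A (y t) - F_A' (y t) v"] remD[of "y t" v] remA[of "y t" v] by linarith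
      qed
    qed (use h L Q M in auto)
    then have 2: "norm (taylor2_step ?f ?A h (y t) - y (t + h))
        \<le> (2 * Q * (2 * M)\<^sup>2 + (2 * L)\<^sup>2 * (2 * M)) * h ^ 3"
      by (simp add: norm_minus_commute)
    show ?thesis
      using norm_diff_triangle_le[OF 1 2] by (simp add: C3_def algebra_simps)
  qed

  obtain c where c: "0 \<le> c" "\<And>x. nrm x \<le> c * norm x" using is_norm_le_euclidean[OF nrm] by auto
  have global: "nrm (y (real n * h) - arkc F_D F_A (s N) (\<eta> N) h y0 n) \<le> (c * (T * C3 * exp (C1 * T))) * h\<^sup>2"
    if N: "N \<ge> 1" and n: "n \<le> N" and h_def: "h = T / real N" for N n h
  proof -
    have h: "0 \<le> h" "h \<le> T" "real N * h = T" using N T by (auto simp: h_def field_simps)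
    have nT: "real n * h \<le> T" if "n \<le> N" for n
      using mult_right_mono[of "real n" "real N" h] that h by simp
    define e where "e n = norm (arkc F_D F_A (s N) (\<eta> N) h y0 n - y (real n * h))" for n
    have "e (Suc n) \<le> (1 + C1 * h) * e n + C3 * h ^ 3" if "n < N" for n
    proof -
      let ?\<Phi> = "arkc_step F_D F_A (s N) (\<eta> N) h"
      have 1: "norm (?\<Phi> (arkc F_D F_A (s N) (\<eta> N) h y0 n) - ?\<Phi> (y (real n * h))) \<le> (1 + C1 * h) * e n"
        unfolding e_def by (rule stable[OF params[OF N] h(1,2)])
      have 2: "norm (?\<Phi> (y (real n * h)) - y (real n * h + h)) \<le> C3 * h ^ 3"
        by (rule local[OF N]) (use h nT[of "Suc n"] that in \<open>auto simp: algebra_simps\<close>)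
      from norm_diff_triangle_le[OF 1 2] show ?thesis
        by (simp add: e_def arkc_def algebra_simps)
    qed
    then have "e n \<le> real n * (C3 * h ^ 3) * (1 + C1 * h) ^ n"
      using h C1 C3 n by (intro one_step_error_accumulation[of e _ _ N]) (auto simp: e_def arkc_def initial)
    also have "\<dots> = C3 * h\<^sup>2 * ((real n * h) * (1 + C1 * h) ^ n)"
      by (simp add: power2_eq_square power3_eq_cube)
    also have "\<dots> \<le> C3 * h\<^sup>2 * (T * exp (C1 * T))"
    proof (intro mult_left_mono mult_mono nT n)
      have "C1 * h = C1 * T / real N" by (simp add: h_def)
      then show "(1 + C1 * h) ^ n \<le> exp (C1 * T)"
        using one_plus_over_power_le_exp[of "C1 * T" N n] N n C1 T by simp
    qed (use h C1 C3 T in auto)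
    finally have "c * e n \<le> c * (C3 * h\<^sup>2 * (T * exp (C1 * T)))"
      using c by (intro mult_left_mono)
    then show ?thesis
      using c(2)[of "y (real n * h) - arkc F_D F_A (s N) (\<eta> N) h y0 n"]
      by (simp add: e_def norm_minus_commute mult_ac)
  qed
  then show ?thesis unfolding Let_def by (metis atLeastAtMost_iff)
qed

end
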